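(* Let $\mathcal C$ be a small subcategory of the category of (small) dg-categories over $k$ and dg-functors, let $\mathcal O$ be a contractible 2-operad with $\mathcal O$-algebra structures on the $\mathcal C$-complexes $\hom$ and $\mathrm{Rhom}$ such that (1) the natural map $\hom\to\mathrm{Rhom}$ is a map of $\mathcal O$-algebras and (2) the $\mathcal O$-algebra structure on $\hom$ is the pull-back, via $\mathcal O\to\mathbf{triv}$, of the standard $\mathbf{triv}$-algebra structure on $\hom$. Then for every dg-category $\mathcal A$ in $\mathcal C$, the Hochschild complex $\mathbf{Hoch}_{\mathcal A}:=\mathrm{Rhom}(\mathrm{Id}_{\mathcal A},\mathrm{Id}_{\mathcal A})$ has an (induced) structure of an algebra over the 2-operad $\mathcal O$.
   Context: Conventions. $k$ is the ground commutative ring; complexes are complexes of $k$-modules with the usual Koszul sign rule. Ordinals. An ordinal is a finite non-empty totally ordered set $I$; $m_I,M_I$ are its minimum and maximum; $[n]=\{0<\dots<n\}$. $\vec I$ is the (possibly empty) totally ordered set of pairs $\vec{ij}$ with $j$ the immediate successor of $i$; $s(\vec{ij})=i$, $t(\vec{ij})=j$. $\Delta$ is the category of ordinals and non-decreasing maps. A non-decreasing map is dominant if it preserves the minimum and the maximum. Natural transformations. For a dg-category $A$ and $X:I\to \mathrm{Ob}\,A$ put $A(X)=\bigotimes_{\vec\imath\in\vec I}A(X(s(\vec\imath)),X(t(\vec\imath)))$ (factors in the order of composition; $A(X)=k$ if $|I|=1$). A dominant map $\kappa:J\to I$ induces $\kappa^*:A(X)\to A(X\circ \kappa)$: for each $\vec{jj'}\in\vec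 J$ compose the arrows over the interval $[\kappa(j),\kappa(j')]$ (insert the identity if $\kappa(j)=\kappa(j')$). For dg-functors $F,G:A\to B$ put $$\mathbf{hom}^I(F,G)=\prod_{X:I\to \mathrm{Ob} A}\hom_k\big(A(X),\hom_B(F(X(m_I)),G(X(M_I)))\big).$$ Let $I'=I\cup\{m',M'\}$ with $m'<I<M'$. For $\Phi\in\mathbf{hom}^I(F,G)$ define $\Phi'\in\mathbf{hom}^{I'}(F,G)$ by $\Phi'(\omega\otimes U\otimes\alpha)=G(\omega)\circ\Phi(U)\circ F(\alpha)$, using $A(X')\cong A(X(M_I),X'(M'))\otimes A(X)\otimes A(X'(m'),X(m_I))$ with $X=X'|_I$. For non-decreasing $\sigma:I\to J$ let $\sigma':I'\to J$ extend $\sigma$ by $m'\mapsto m_J$, $M'\mapsto M_J$, and set $(\sigma_*\Phi)(U)=\Phi'((\sigma')^*U)$. This makes $I\mapsto\mathbf{hom}^I(F,G)$ a co-simplicial complex $\mathbf{hom}^\bullet(F,G)$. Let $\mathcal S$ be the co-simplicial complex $\mathcal S^*(I)=C_{-*}(\Delta^I)$, the normalized simplicial chains with coefficients in $k$ of the simplex with vertex set $I$. For a co-simplicial complex $K$ let $|K|=\hom_\Delta(\mathcal S,K)$ be the complex of (graded) maps of co-simplicial objects. Put $\mathrm{Rhom}(F,G)=|\mathbf{hom}^\bullet(F,G)|$. The naive complex $\hom(F,G)$ is the equalizer of the two co-face maps $\mathbf{hom}^{[0]}(F,G)\rightrightarrows\mathbf{hom}^{[1]}(F,G)$. Viewing $\hom(F,G)$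 as a constant co-simplicial complex, there is a co-simplicial map to $\mathbf{hom}^\bullet(F,G)$ (in degree $I$: apply $\sigma_*$ for any $\sigma:[0]\to I$); combined with the augmentations $\mathcal S(I)\to k$ it gives the natural map $\hom(F,G)\to\mathrm{Rhom}(F,G)$. 2-ordinals. A 2-ordinal $\mathcal U$ consists of an ordinal $C_{\mathcal U}$ and an ordinal $F_{\mathcal U,\vec c}$ for each $\vec c\in\vec C_{\mathcal U}$. Put $\vec F_{\mathcal U}=\bigsqcup_{\vec c}\vec F_{\mathcal U,\vec c}$ (the 2-cells). $[\mathcal U]$ is the strict 2-category with object set $C_{\mathcal U}$ in which $\mathrm{Hom}(c,c')$ is empty for $c>c'$ and for $c\le c'$ is the poset $\prod_{\vec c\in\overrightarrow{[c,c']}}F_{\mathcal U,\vec c}$ (componentwise order; a single element $\mathrm{Id}_c$ if $c=c'$) viewed as a category; 1-arrows compose by concatenation. $[\mathcal U]_1$ is its underlying 1-category. The globe $\mathbf{globe}$ has $C=\{c_0<c_1\}$, $F_{\vec{c_0c_1}}=\{f_0<f_1\}$; 2-ordinals isomorphic to it are also called globes. A map of 2-ordinals $P:\mathcal U\to\mathcal V$ is a 2-functor $[P]:[\mathcal V]\to[\mathcal U]$ such that $C_{\mathcal V}\to C_{\mathcal U}$ is dominant and, for all $c_1<c_2$ in $C_{\mathcal V}$, the map $\mathrm{Hom}_{[\mathcal V]}(c_1,c_2)\to\mathrm{Hom}_{[\mathcal U]}([P]c_1,[P]c_2)$ preserves least and greatest elements. A globe is terminal; $p:\mathcal U\to\mathbf{globe}$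 denotes the terminal map. A ball $\mathcal U'$ in $\mathcal U$ is a 2-ordinal with $C_{\mathcal U'}$ an interval of $C_{\mathcal U}$ and each $F_{\mathcal U',\vec c}$ an interval of $F_{\mathcal U,\vec c}$; each $\vec f\in\vec F_{\mathcal U}$ is identified with the corresponding globe (a ball) in $\mathcal U$. For $P:\mathcal U\to\mathcal V$ and a ball $\mathcal V'\subset\mathcal V$, $P^{-1}\mathcal V'$ is the unique ball $\mathcal U'\subset\mathcal U$ for which there is a map $P':\mathcal U'\to\mathcal V'$ with $[P']$ the restriction of $[P]$ to $[\mathcal V']$. One has $\vec F_{\mathcal U}=\bigsqcup_{\vec f\in\vec F_{\mathcal V}}\vec F_{P^{-1}\vec f}$. 2-operads. A 2-operad $\mathcal O$ is a functor from the groupoid of 2-ordinals and isomorphisms to complexes, together with, for each map $P:\mathcal U\to\mathcal V$, a map $\circ_P:\mathcal O(P)\otimes\mathcal O(\mathcal V)\to\mathcal O(\mathcal U)$, where $\mathcal O(P)=\bigotimes_{\vec f\in\vec F_{\mathcal V}}\mathcal O(P^{-1}\vec f)$; these are equivariant under isomorphisms and associative: for $\mathcal U\xrightarrow{P}\mathcal V\xrightarrow{Q}\mathcal W$ the maps $\circ_{P_{\vec f}}$, where $P_{\vec f}:(QP)^{-1}\vec f\to Q^{-1}\vec f$ ($\vec f\in\vec F_{\mathcal W}$) are the induced maps, give $\circ(Q,P):\mathcal O(P)\otimes\mathcal O(Q)\to\mathcal O(QP)$, and these are required to be associative for chains of three maps. $\mathbf{triv}$ is the 2-operad with $\mathbf{triv}(\mathcal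 U)=k$ and all structure maps preserving $1$. A contractible 2-operad is a 2-operad $\mathcal O$ together with a quasi-isomorphism of 2-operads $\mathcal O\to\mathbf{triv}$. Algebras over $\mathcal C$-complexes. A globe in $\mathcal C$ is a pair of objects with two arrows $f_0,f_1:A_0\to A_1$. A $\mathcal C$-complex is a family of complexes $K_g$ indexed by the globes $g$ in $\mathcal C$. A $\mathcal U$-diagram in $\mathcal C$ is a functor $D:[\mathcal U]_1\to\mathcal C$; for $P:\mathcal U\to\mathcal V$, $P_*D=D\circ[P]$, and $D|_{\mathcal U'}$ is the restriction to a ball; so $D|_{\vec f}$ ($\vec f\in\vec F_{\mathcal U}$) and $p_*D$ are globes in $\mathcal C$. For a $\mathcal C$-complex $K$, $\mathbf{full}_K$ is the 2-operad $$\mathbf{full}_K(\mathcal U)=\prod_{D}\hom_k\Big(\bigotimes_{\vec f\in\vec F_{\mathcal U}}K_{D|_{\vec f}},\,K_{p_*D}\Big)$$ (product over all $\mathcal U$-diagrams in $\mathcal C$), with $\circ_P$ given by composing the operations for $D|_{P^{-1}\vec f}$, $\vec f\in\vec F_{\mathcal V}$, with the operation for $P_*D$. An $\mathcal O$-algebra structure on $K$ is a map of 2-operads $\mathcal O\to\mathbf{full}_K$; a map of $\mathcal O$-algebras is a map of $\mathcal C$-complexes commuting with all operations. $\hom$ and $\mathrm{Rhom}$ denote the $\mathcal C$-complexes assigning to a globe $F,G:A\to B$ the complexes $\hom(F,G)$ and $\mathrm{Rhom}(F,G)$. The standard $\mathbf{triv}$-algebra structure on $\hom$ sends $1\in\mathbf{triv}(\mathcal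 U)$ to the operation composing natural transformations (vertically and horizontally) along the diagram $D$. Algebras on a single complex. For a complex $K$, $\mathbf{full}_K$ is the 2-operad $\mathbf{full}_K(\mathcal U)=\hom_k(K^{\otimes\vec F_{\mathcal U}},K)$ with the obvious insertion maps (the case of the category with one object and one arrow); an $\mathcal O$-algebra structure on $K$ is a map of 2-operads $\mathcal O\to\mathbf{full}_K$. "Induced" means: obtained from the operations on $\mathrm{Rhom}$ for the constant $\mathcal U$-diagrams (all objects $\mathcal A$, all arrows $\mathrm{Id}_{\mathcal A}$). *)

theory Defs
  imports "HOL-Algebra.Module" "HOL-Algebra.AbelCoset" "HOL-Library.FuncSet"
begin

section \<open>Complexes\<close>

text \<open>
  The ground ring is a commutative ring \<^term>\<open>R\<close> in the sense of HOL-Algebra. Complexes are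
  cohomologically graded. Functions and families with a prescribed domain are extensional
  (\<^const>\<open>undefined\<close> off the domain), so that HOL equality is the intended equality.
\<close>

record ('k, 'a) cx =
  Deg :: "int \<Rightarrow> ('k, 'a) module"
  dif :: "int \<Rightarrow> 'a \<Rightarrow> 'a"

definition lin :: "('k, 'r) ring_scheme \<Rightarrow> ('k, 'a) module \<Rightarrow> ('k, 'b) module \<Rightarrow> ('a \<Rightarrow> 'b) \<Rightarrow> bool" where
  "lin R M N f \<longleftrightarrow>
     f \<in> carrier M \<rightarrow> carrier N \<and>
     (\<forall>x\<in>carrier M. \<forall>y\<in>carrier M. f (x \<oplus>\<^bsub>M\<^esub> y) = f x \<oplus>\<^bsub>N\<^esub> f y) \<and>
     (\<forall>r\<in>carrier R. \<forall>x\<in>carrier M. f (r \<odot>\<^bsub>M\<^esub> x) = r \<odot>\<^bsub>N\<^esub> f x)"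

definition is_cx :: "('k, 'r) ring_scheme \<Rightarrow> ('k, 'a) cx \<Rightarrow> bool" where
  "is_cx R K \<longleftrightarrow>
     (\<forall>n. module R (Deg K n)) \<and>
     (\<forall>n. lin R (Deg K n) (Deg K (n + 1)) (dif K n)) \<and>
     (\<forall>n. \<forall>x\<in>carrier (Deg K n). dif K (n + 1) (dif K n x) = \<zero>\<^bsub>Deg K (n + 2)\<^esub>)"

definition chain_map ::
    "('k, 'r) ring_scheme \<Rightarrow> ('k, 'a) cx \<Rightarrow> ('k, 'b) cx \<Rightarrow> (int \<Rightarrow> 'a \<Rightarrow> 'b) \<Rightarrow> bool" where
  "chain_map R K L \<phi> \<longleftrightarrow>
     (\<forall>n. lin R (Deg K n) (Deg L n) (\<phi> n)) \<and>
     (\<forall>n. \<forall>x\<in>carrier (Deg K n). \<phi> (n + 1) (dif K n x) = dif L n (\<phi> n x))"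

definition cocycles :: "('k, 'a) cx \<Rightarrow> int \<Rightarrow> 'a set" where
  "cocycles K n = {x \<in> carrier (Deg K n). dif K n x = \<zero>\<^bsub>Deg K (n + 1)\<^esub>}"

definition cobounds :: "('k, 'a) cx \<Rightarrow> int \<Rightarrow> 'a set" where
  "cobounds K n = dif K (n - 1) ` carrier (Deg K (n - 1))"

definition cohomology :: "('k, 'a) cx \<Rightarrow> int \<Rightarrow> 'a set set" where
  "cohomology K n = (\<lambda>x. cobounds K n +>\<^bsub>Deg K n\<^esub> x) ` cocycles K n"

text \<open>The map induced on cohomology sends a coset \<^term>\<open>c\<close> to the union of the
  (all equal) cosets of the images of its elements.\<close>

definition quasi_iso ::
    "('k, 'r) ring_scheme \<Rightarrow> ('k, 'a) cx \<Rightarrow> ('k, 'b) cx \<Rightarrow> (int \<Rightarrow> 'a \<Rightarrow> 'b) \<Rightarrow> bool" where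
  "quasi_iso R K L \<phi> \<longleftrightarrow>
     chain_map R K L \<phi> \<and>
     (\<forall>n. bij_betw (\<lambda>c. \<Union>x\<in>c. cobounds L n +>\<^bsub>Deg L n\<^esub> \<phi> n x) (cohomology K n) (cohomology L n))"

definition sgm :: "('a, 'r) ring_scheme \<Rightarrow> int \<Rightarrow> 'a \<Rightarrow> 'a" where
  "sgm M e x = (if even e then x else \<ominus>\<^bsub>M\<^esub> x)"

definition mk_mod :: "'b set \<Rightarrow> 'b \<Rightarrow> ('b \<Rightarrow> 'b \<Rightarrow> 'b) \<Rightarrow> ('a \<Rightarrow> 'b \<Rightarrow> 'b) \<Rightarrow> ('a, 'b) module" where
  "mk_mod S z a s =
     \<lparr>carrier = S, monoid.mult = undefined, one = undefined, zero = z, add = a, smult = s\<rparr>"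

definition ground_cx :: "('k, 'r) ring_scheme \<Rightarrow> ('k, 'k) cx" where
  "ground_cx R =
     \<lparr>Deg = (\<lambda>n. mk_mod (if n = 0 then carrier R else {\<zero>\<^bsub>R\<^esub>}) \<zero>\<^bsub>R\<^esub> (\<lambda>x y. x \<oplus>\<^bsub>R\<^esub> y) (\<lambda>x y. x \<otimes>\<^bsub>R\<^esub> y)),
      dif = (\<lambda>_ _. \<zero>\<^bsub>R\<^esub>)\<rparr>"

definition prod_cx :: "'j set \<Rightarrow> ('j \<Rightarrow> ('k, 'a) cx) \<Rightarrow> ('k, 'j \<Rightarrow> 'a) cx" where
  "prod_cx J K =
     \<lparr>Deg = (\<lambda>p. mk_mod (\<Pi>\<^sub>E j\<in>J. carrier (Deg (K j) p)) (\<lambda>j\<in>J. \<zero>\<^bsub>Deg (K j) p\<^esub>)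
               (\<lambda>x y. \<lambda>j\<in>J. x j \<oplus>\<^bsub>Deg (K j) p\<^esub> y j) (\<lambda>r x. \<lambda>j\<in>J. r \<odot>\<^bsub>Deg (K j) p\<^esub> x j)),
      dif = (\<lambda>p x. \<lambda>j\<in>J. dif (K j) p (x j))\<rparr>"

definition sub_cx :: "('k, 'a) cx \<Rightarrow> (int \<Rightarrow> 'a set) \<Rightarrow> ('k, 'a) cx" where
  "sub_cx K S =
     \<lparr>Deg = (\<lambda>p. (Deg K p)\<lparr>carrier := carrier (Deg K p) \<inter> S p\<rparr>), dif = dif K\<rparr>"

subsection \<open>Tensor products and the complex of maps out of them\<close>

text \<open>
  A homogeneous element is a pair (degree, element). A tensor product of a finite family \<^term>\<open>M\<close>
  of complexes is only ever used as the source of maps, and a map out of it is the same thing as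
  a multilinear operation on homogeneous elements. The list \<^term>\<open>L\<close> (of distinct indices)
  fixes the order of the factors; it is what the Koszul signs refer to. A family in
  \<^term>\<open>pure M L\<close> stands for the tensor product of its members in that order.
\<close>

definition hel :: "('k, 'a) cx \<Rightarrow> (int \<times> 'a) set" where
  "hel K = {(n, x). x \<in> carrier (Deg K n)}"

definition pure :: "('i \<Rightarrow> ('k, 'a) cx) \<Rightarrow> 'i list \<Rightarrow> ('i \<Rightarrow> int \<times> 'a) set" where
  "pure M L = (\<Pi>\<^sub>E i\<in>set L. hel (M i))"

definition tdeg :: "'i list \<Rightarrow> ('i \<Rightarrow> int \<times> 'a) \<Rightarrow> int" where
  "tdeg L h = (\<Sum>i\<in>set L. fst (h i))"

text \<open>The differential is
  $(df)(h) = d(f(h)) - (-1)^p \sum_j (-1)^{|h_1|+\dots+|h_{j-1}|} f(h_1,\dots,dh_j,\dots,h_n)$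
  for $f$ of degree $p$. The degree $p$ part of the complex of maps between two graded modules is
  the product over all source degrees, which is why no bound on the degrees of \<^term>\<open>h\<close> occurs.\<close>

definition hom_cx ::
    "('k, 'r) ring_scheme \<Rightarrow> ('i \<Rightarrow> ('k, 'a) cx) \<Rightarrow> 'i list \<Rightarrow> ('k, 'b) cx
      \<Rightarrow> ('k, ('i \<Rightarrow> int \<times> 'a) \<Rightarrow> 'b) cx" where
  "hom_cx R M L N =
     \<lparr>Deg = (\<lambda>p. mk_mod
        {f \<in> extensional (pure M L). \<forall>h\<in>pure M L.
            f h \<in> carrier (Deg N (p + tdeg L h)) \<and>
            (\<forall>i\<in>set L. lin R (Deg (M i) (fst (h i))) (Deg N (p + tdeg L h))
                          (\<lambda>x. f (h(i := (fst (h i), x)))))}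
        (\<lambda>h\<in>pure M L. \<zero>\<^bsub>Deg N (p + tdeg L h)\<^esub>)
        (\<lambda>f g. \<lambda>h\<in>pure M L. f h \<oplus>\<^bsub>Deg N (p + tdeg L h)\<^esub> g h)
        (\<lambda>r f. \<lambda>h\<in>pure M L. r \<odot>\<^bsub>Deg N (p + tdeg L h)\<^esub> f h)),
      dif = (\<lambda>p f. \<lambda>h\<in>pure M L.
        let N' = Deg N (p + tdeg L h + 1) in
        dif N (p + tdeg L h) (f h) \<ominus>\<^bsub>N'\<^esub>
          sgm N' p (\<Oplus>\<^bsub>N'\<^esub> j\<in>{..<length L}.
            sgm N' (\<Sum>i<j. fst (h (L ! i)))
              (f (h(L ! j := (fst (h (L ! j)) + 1,
                              dif (M (L ! j)) (fst (h (L ! j))) (snd (h (L ! j)))))))))\<rparr>"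

abbreviation hom1_cx ::
    "('k, 'r) ring_scheme \<Rightarrow> ('k, 'a) cx \<Rightarrow> ('k, 'b) cx \<Rightarrow> ('k, (unit \<Rightarrow> int \<times> 'a) \<Rightarrow> 'b) cx" where
  "hom1_cx R M N \<equiv> hom_cx R (\<lambda>_. M) [()] N"

text \<open>Chain maps from a tensor product to \<^term>\<open>N\<close>, i.e. the cocycles of degree 0.\<close>

definition mchain ::
    "('k, 'r) ring_scheme \<Rightarrow> ('i \<Rightarrow> ('k, 'a) cx) \<Rightarrow> 'i list \<Rightarrow> ('k, 'b) cx
      \<Rightarrow> (('i \<Rightarrow> int \<times> 'a) \<Rightarrow> 'b) \<Rightarrow> bool" where
  "mchain R M L N f \<longleftrightarrow> restrict f (pure M L) \<in> cocycles (hom_cx R M L N) 0"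

text \<open>The Koszul sign of reordering a tensor product of elements of degrees \<^term>\<open>deg\<close> from the
  order \<^term>\<open>L\<close> to the order \<^term>\<open>L'\<close> is $(-1)$ to the power \<^term>\<open>kosz deg L L'\<close>.\<close>

definition before :: "'i list \<Rightarrow> 'i \<Rightarrow> 'i \<Rightarrow> bool" where
  "before L a b \<longleftrightarrow> (\<exists>i j. i < j \<and> j < length L \<and> L ! i = a \<and> L ! j = b)"

definition kosz :: "('i \<Rightarrow> int) \<Rightarrow> 'i list \<Rightarrow> 'i list \<Rightarrow> int" where
  "kosz deg L L' = (\<Sum>(a, b)\<in>{(a, b). before L a b \<and> before L' b a}. deg a * deg b)"


section \<open>Ordinals\<close>

text \<open>Ordinals are represented by finite non-empty sets of integers. Every finite non-empty totally
  ordered set is (uniquely) isomorphic to such a set, and the representation is closed under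
  passing to intervals and under adjoining a new minimum and maximum.\<close>

definition ordinal :: "int set \<Rightarrow> bool" where
  "ordinal I \<longleftrightarrow> finite I \<and> I \<noteq> {}"

definition arrows :: "int set \<Rightarrow> (int \<times> int) set" where
  "arrows I = {(i, j). i \<in> I \<and> j \<in> I \<and> i < j \<and> \<not> (\<exists>l\<in>I. i < l \<and> l < j)}"

text \<open>The arrows in the order of composition: the last arrow comes first.\<close>

definition arrow_list :: "int set \<Rightarrow> (int \<times> int) list" where
  "arrow_list I = (let xs = sorted_list_of_set I in rev (zip xs (tl xs)))"

definition nondecr :: "int set \<Rightarrow> int set \<Rightarrow> (int \<Rightarrow> int) set" where
  "nondecr I J = {\<sigma> \<in> I \<rightarrow>\<^sub>E J. \<forall>i\<in>I. \<forall>j\<in>I. i \<le> j \<longrightarrow> \<sigma> i \<le> \<sigma> j}"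

definition dominant :: "int set \<Rightarrow> int set \<Rightarrow> (int \<Rightarrow> int) \<Rightarrow> bool" where
  "dominant I J \<sigma> \<longleftrightarrow> \<sigma> \<in> nondecr I J \<and> \<sigma> (Min I) = Min J \<and> \<sigma> (Max I) = Max J"

definition interval :: "int set \<Rightarrow> int set \<Rightarrow> bool" where
  "interval J I \<longleftrightarrow> (\<exists>a\<in>I. \<exists>b\<in>I. a \<le> b \<and> J = I \<inter> {a..b})"


section \<open>Dg-categories\<close>

text \<open>\<^term>\<open>cmp A x y z g f\<close> is the composite of homogeneous $f : x \to y$ and $g : y \to z$.\<close>

record ('k, 'o, 'm) dgcat =
  Ob :: "'o set"
  Mor :: "'o \<Rightarrow> 'o \<Rightarrow> ('k, 'm) cx"
  cmp :: "'o \<Rightarrow> 'o \<Rightarrow> 'o \<Rightarrow> int \<times> 'm \<Rightarrow> int \<times> 'm \<Rightarrow> 'm"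
  idn :: "'o \<Rightarrow> 'm"

definition hcmp :: "('k, 'o, 'm) dgcat \<Rightarrow> 'o \<Rightarrow> 'o \<Rightarrow> 'o \<Rightarrow> int \<times> 'm \<Rightarrow> int \<times> 'm \<Rightarrow> int \<times> 'm" where
  "hcmp A x y z g f = (fst g + fst f, cmp A x y z g f)"

definition dg_category :: "('k, 'r) ring_scheme \<Rightarrow> ('k, 'o, 'm) dgcat \<Rightarrow> bool" where
  "dg_category R A \<longleftrightarrow>
     (\<forall>x\<in>Ob A. \<forall>y\<in>Ob A. is_cx R (Mor A x y)) \<and>
     (\<forall>x\<in>Ob A. \<forall>y\<in>Ob A. \<forall>z\<in>Ob A.
        mchain R (\<lambda>b. if b then Mor A y z else Mor A x y) [True, False] (Mor A x z)
          (\<lambda>h. cmp A x y z (h True) (h False))) \<and>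
     (\<forall>x\<in>Ob A. idn A x \<in> cocycles (Mor A x x) 0) \<and>
     (\<forall>x\<in>Ob A. \<forall>y\<in>Ob A. \<forall>f\<in>hel (Mor A x y).
        hcmp A x x y f (0, idn A x) = f \<and> hcmp A x y y (0, idn A y) f = f) \<and>
     (\<forall>w\<in>Ob A. \<forall>x\<in>Ob A. \<forall>y\<in>Ob A. \<forall>z\<in>Ob A.
        \<forall>f\<in>hel (Mor A w x). \<forall>g\<in>hel (Mor A x y). \<forall>h\<in>hel (Mor A y z).
          hcmp A w y z h (hcmp A w x y g f) = hcmp A w x z (hcmp A x y z h g) f)"

record ('o, 'm) dgfun =
  fO :: "'o \<Rightarrow> 'o"
  fM :: "'o \<Rightarrow> 'o \<Rightarrow> int \<Rightarrow> 'm \<Rightarrow> 'm"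

definition hmap :: "('o, 'm) dgfun \<Rightarrow> 'o \<Rightarrow> 'o \<Rightarrow> int \<times> 'm \<Rightarrow> int \<times> 'm" where
  "hmap F x y u = (fst u, fM F x y (fst u) (snd u))"

definition morset :: "('k, 'o, 'm) dgcat \<Rightarrow> 'o \<Rightarrow> 'o \<Rightarrow> int \<Rightarrow> 'm set" where
  "morset A x y n = (if x \<in> Ob A \<and> y \<in> Ob A then carrier (Deg (Mor A x y) n) else {})"

definition dg_functor ::
    "('k, 'r) ring_scheme \<Rightarrow> ('k, 'o, 'm) dgcat \<Rightarrow> ('k, 'o, 'm) dgcat \<Rightarrow> ('o, 'm) dgfun \<Rightarrow> bool" where
  "dg_functor R A B F \<longleftrightarrow>
     fO F \<in> Ob A \<rightarrow>\<^sub>E Ob B \<and>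
     (\<forall>x y n. fM F x y n \<in> extensional (morset A x y n)) \<and>
     (\<forall>x\<in>Ob A. \<forall>y\<in>Ob A. chain_map R (Mor A x y) (Mor B (fO F x) (fO F y)) (fM F x y)) \<and>
     (\<forall>x\<in>Ob A. fM F x x 0 (idn A x) = idn B (fO F x)) \<and>
     (\<forall>x\<in>Ob A. \<forall>y\<in>Ob A. \<forall>z\<in>Ob A. \<forall>f\<in>hel (Mor A x y). \<forall>g\<in>hel (Mor A y z).
        hmap F x z (hcmp A x y z g f) =
        hcmp B (fO F x) (fO F y) (fO F z) (hmap F y z g) (hmap F x y f))"

definition id_fun :: "('k, 'o, 'm) dgcat \<Rightarrow> ('o, 'm) dgfun" where
  "id_fun A = \<lparr>fO = (\<lambda>x\<in>Ob A. x), fM = (\<lambda>x y n. \<lambda>u\<in>morset A x y n. u)\<rparr>"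

definition comp_fun ::
    "('k, 'o, 'm) dgcat \<Rightarrow> ('o, 'm) dgfun \<Rightarrow> ('o, 'm) dgfun \<Rightarrow> ('o, 'm) dgfun" where
  "comp_fun A G F =
     \<lparr>fO = compose (Ob A) (fO G) (fO F),
      fM = (\<lambda>x y n. compose (morset A x y n) (fM G (fO F x) (fO F y) n) (fM F x y n))\<rparr>"

record ('k, 'o, 'm) subcat =
  cOb :: "('k, 'o, 'm) dgcat set"
  cAr :: "('k, 'o, 'm) dgcat \<Rightarrow> ('k, 'o, 'm) dgcat \<Rightarrow> ('o, 'm) dgfun set"

definition dg_subcategory :: "('k, 'r) ring_scheme \<Rightarrow> ('k, 'o, 'm) subcat \<Rightarrow> bool" where
  "dg_subcategory R C \<longleftrightarrow>
     (\<forall>A\<in>cOb C. dg_category R A \<and> id_fun A \<in> cAr C A A) \<and>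
     (\<forall>A\<in>cOb C. \<forall>B\<in>cOb C. \<forall>F\<in>cAr C A B. dg_functor R A B F) \<and>
     (\<forall>A\<in>cOb C. \<forall>B\<in>cOb C. \<forall>D\<in>cOb C. \<forall>F\<in>cAr C A B. \<forall>G\<in>cAr C B D. comp_fun A G F \<in> cAr C A D)"

text \<open>\<^term>\<open>(A, B, F, G)\<close> is the globe $F, G : A \to B$.\<close>

type_synonym ('k, 'o, 'm) globe =
  "('k, 'o, 'm) dgcat \<times> ('k, 'o, 'm) dgcat \<times> ('o, 'm) dgfun \<times> ('o, 'm) dgfun"

definition globes :: "('k, 'o, 'm) subcat \<Rightarrow> ('k, 'o, 'm) globe set" where
  "globes C = {(A, B, F, G). A \<in> cOb C \<and> B \<in> cOb C \<and> F \<in> cAr C A B \<and> G \<in> cAr C A B}"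


section \<open>The co-simplicial complex of natural transformations\<close>

abbreviation path_fam :: "('k, 'o, 'm) dgcat \<Rightarrow> (int \<Rightarrow> 'o) \<Rightarrow> int \<times> int \<Rightarrow> ('k, 'm) cx" where
  "path_fam A X \<equiv> (\<lambda>(i, j). Mor A (X i) (X j))"

text \<open>\<^term>\<open>path A X u i ps\<close> is the composite of the \<^term>\<open>u a\<close> for the consecutive arrows
  \<^term>\<open>a\<close> in \<^term>\<open>ps\<close> (last arrow first), starting at \<^term>\<open>i\<close>.\<close>

fun path :: "('k, 'o, 'm) dgcat \<Rightarrow> (int \<Rightarrow> 'o) \<Rightarrow> (int \<times> int \<Rightarrow> int \<times> 'm) \<Rightarrow> int \<Rightarrow> (int \<times> int) list
    \<Rightarrow> int \<times> 'm" where
  "path A X u i [] = (0, idn A (X i))"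
| "path A X u i ((a, b) # ps) = hcmp A (X i) (X a) (X b) (u (a, b)) (path A X u i ps)"

text \<open>$\kappa^* : A(X) \to A(X \circ \kappa)$ for dominant $\kappa : J \to I$. As the factors are in
  the order of composition, no signs occur.\<close>

definition pull ::
    "('k, 'o, 'm) dgcat \<Rightarrow> (int \<Rightarrow> 'o) \<Rightarrow> int set \<Rightarrow> int set \<Rightarrow> (int \<Rightarrow> int)
      \<Rightarrow> (int \<times> int \<Rightarrow> int \<times> 'm) \<Rightarrow> (int \<times> int \<Rightarrow> int \<times> 'm)" where
  "pull A X I J \<kappa> u =
     restrict (\<lambda>(j, j'). path A X u (\<kappa> j) (arrow_list (I \<inter> {\<kappa> j..\<kappa> j'}))) (arrows J)"

definition hom_at ::
    "('k, 'r) ring_scheme \<Rightarrow> ('k, 'o, 'm) globe \<Rightarrow> int set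
      \<Rightarrow> ('k, (int \<Rightarrow> 'o) \<Rightarrow> (int \<times> int \<Rightarrow> int \<times> 'm) \<Rightarrow> 'm) cx" where
  "hom_at R = (\<lambda>(A, B, F, G) I.
     prod_cx (I \<rightarrow>\<^sub>E Ob A) (\<lambda>X.
       hom_cx R (path_fam A X) (arrow_list I) (Mor B (fO F (X (Min I))) (fO G (X (Max I))))))"

definition ext_ord :: "int set \<Rightarrow> int set" where
  "ext_ord I = insert (Min I - 1) (insert (Max I + 1) I)"

text \<open>\<^term>\<open>prime_op g I p \<Phi>\<close> is $\Phi'$ for $\Phi$ of degree \<^term>\<open>p\<close>:
  $\Phi'(\omega\otimes U\otimes\alpha) = (-1)^{p|\omega|}\, G(\omega)\circ\Phi(U)\circ F(\alpha)$,
  the sign being the Koszul sign of moving $\Phi$ past $\omega$.\<close>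

definition prime_op ::
    "('k, 'o, 'm) globe \<Rightarrow> int set \<Rightarrow> int \<Rightarrow> ((int \<Rightarrow> 'o) \<Rightarrow> (int \<times> int \<Rightarrow> int \<times> 'm) \<Rightarrow> 'm)
      \<Rightarrow> (int \<Rightarrow> 'o) \<Rightarrow> (int \<times> int \<Rightarrow> int \<times> 'm) \<Rightarrow> 'm" where
  "prime_op = (\<lambda>(A, B, F, G) I p \<Phi> X' h.
     let m = Min I; M = Max I; m' = Min I - 1; M' = Max I + 1;
         \<omega> = h (M, M'); \<alpha> = h (m', m);
         X = restrict X' I; U = restrict h (arrows I);
         t = hcmp B (fO F (X' m')) (fO G (X' M)) (fO G (X' M')) (hmap G (X' M) (X' M') \<omega>)
               (hcmp B (fO F (X' m')) (fO F (X' m)) (fO G (X' M))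
                  (p + tdeg (arrow_list I) U, \<Phi> X U)
                  (hmap F (X' m') (X' m) \<alpha>))
     in sgm (Deg (Mor B (fO F (X' m')) (fO G (X' M'))) (fst t)) (p * fst \<omega>) (snd t))"

definition ext_map :: "int set \<Rightarrow> int set \<Rightarrow> (int \<Rightarrow> int) \<Rightarrow> int \<Rightarrow> int" where
  "ext_map I J \<sigma> = (\<lambda>i\<in>ext_ord I.
     if i = Min I - 1 then Min J else if i = Max I + 1 then Max J else \<sigma> i)"

definition hom_push ::
    "('k, 'o, 'm) globe \<Rightarrow> int set \<Rightarrow> int set \<Rightarrow> (int \<Rightarrow> int)
      \<Rightarrow> int \<Rightarrow> ((int \<Rightarrow> 'o) \<Rightarrow> (int \<times> int \<Rightarrow> int \<times> 'm) \<Rightarrow> 'm)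
      \<Rightarrow> (int \<Rightarrow> 'o) \<Rightarrow> (int \<times> int \<Rightarrow> int \<times> 'm) \<Rightarrow> 'm" where
  "hom_push g I J \<sigma> p \<Phi> =
     (\<lambda>X\<in>J \<rightarrow>\<^sub>E Ob (fst g). \<lambda>u\<in>pure (path_fam (fst g) X) (arrow_list J).
        prime_op g I p \<Phi> (compose (ext_ord I) X (ext_map I J \<sigma>))
          (pull (fst g) X J (ext_ord I) (ext_map I J \<sigma>) u))"

record ('k, 'a) cosimp =
  coOb :: "int set \<Rightarrow> ('k, 'a) cx"
  coAr :: "int set \<Rightarrow> int set \<Rightarrow> (int \<Rightarrow> int) \<Rightarrow> int \<Rightarrow> 'a \<Rightarrow> 'a"

definition hom_cosimp ::
    "('k, 'r) ring_scheme \<Rightarrow> ('k, 'o, 'm) globe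
      \<Rightarrow> ('k, (int \<Rightarrow> 'o) \<Rightarrow> (int \<times> int \<Rightarrow> int \<times> 'm) \<Rightarrow> 'm) cosimp" where
  "hom_cosimp R g = \<lparr>coOb = hom_at R g, coAr = hom_push g\<rparr>"

text \<open>Normalized chains on the simplex with vertex set \<^term>\<open>I\<close>, by their coefficients on the
  non-degenerate simplices, i.e. on the non-empty subsets \<^term>\<open>T\<close> of \<^term>\<open>I\<close>; such a
  \<^term>\<open>T\<close> has degree $-(|T| - 1)$. A map of ordinals that is not injective on \<^term>\<open>T\<close> makes
  it degenerate, i.e. zero.\<close>

definition chains_cx :: "('k, 'r) ring_scheme \<Rightarrow> int set \<Rightarrow> ('k, int set \<Rightarrow> 'k) cx" where
  "chains_cx R I =
     \<lparr>Deg = (\<lambda>q. mk_mod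
        {s. \<forall>T. s T \<in> carrier R \<and> (s T \<noteq> \<zero>\<^bsub>R\<^esub> \<longrightarrow> T \<subseteq> I \<and> T \<noteq> {} \<and> int (card T) = 1 - q)}
        (\<lambda>_. \<zero>\<^bsub>R\<^esub>) (\<lambda>s t T. s T \<oplus>\<^bsub>R\<^esub> t T) (\<lambda>r s T. r \<otimes>\<^bsub>R\<^esub> s T)),
      dif = (\<lambda>q s T. if T \<subseteq> I \<and> T \<noteq> {}
        then \<Oplus>\<^bsub>R\<^esub> t\<in>I - T. sgm R (int (card {x\<in>T. x < t})) (s (insert t T))
        else \<zero>\<^bsub>R\<^esub>)\<rparr>"

definition simplices :: "('k, 'r) ring_scheme \<Rightarrow> ('k, int set \<Rightarrow> 'k) cosimp" where
  "simplices R =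
     \<lparr>coOb = chains_cx R,
      coAr = (\<lambda>I J \<sigma> q s T. \<Oplus>\<^bsub>R\<^esub> T'\<in>{T'. T' \<subseteq> I \<and> \<sigma> ` T' = T \<and> card T' = card T}. s T')\<rparr>"

text \<open>The augmentation \<^term>\<open>aug R I\<close> is to be applied in degree 0 only.\<close>

definition aug :: "('k, 'r) ring_scheme \<Rightarrow> int set \<Rightarrow> (int set \<Rightarrow> 'k) \<Rightarrow> 'k" where
  "aug R I s = (\<Oplus>\<^bsub>R\<^esub> i\<in>I. s {i})"

definition realization ::
    "('k, 'r) ring_scheme \<Rightarrow> ('k, 'a) cosimp
      \<Rightarrow> ('k, int set \<Rightarrow> (unit \<Rightarrow> int \<times> (int set \<Rightarrow> 'k)) \<Rightarrow> 'a) cx" where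
  "realization R K =
     sub_cx (prod_cx {I. ordinal I} (\<lambda>I. hom1_cx R (coOb (simplices R) I) (coOb K I)))
       (\<lambda>p. {\<eta>. \<forall>I J. \<forall>\<sigma>\<in>nondecr I J. ordinal I \<and> ordinal J \<longrightarrow>
          (\<forall>(q, s)\<in>hel (coOb (simplices R) I).
             coAr K I J \<sigma> (p + q) (\<eta> I (\<lambda>_. (q, s))) =
             \<eta> J (\<lambda>_. (q, coAr (simplices R) I J \<sigma> q s)))})"

definition Rhom ::
    "('k, 'r) ring_scheme \<Rightarrow> ('k, 'o, 'm) globe \<Rightarrow> ('k, int set \<Rightarrow> (unit \<Rightarrow> int \<times> (int set \<Rightarrow> 'k))
      \<Rightarrow> (int \<Rightarrow> 'o) \<Rightarrow> (int \<times> int \<Rightarrow> int \<times> 'm) \<Rightarrow> 'm) cx" where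
  "Rhom R g = realization R (hom_cosimp R g)"

definition naive_hom ::
    "('k, 'r) ring_scheme \<Rightarrow> ('k, 'o, 'm) globe
      \<Rightarrow> ('k, (int \<Rightarrow> 'o) \<Rightarrow> (int \<times> int \<Rightarrow> int \<times> 'm) \<Rightarrow> 'm) cx" where
  "naive_hom R g = sub_cx (hom_at R g {0})
     (\<lambda>p. {\<Phi>. hom_push g {0} {0, 1} (\<lambda>i\<in>{0}. 0) p \<Phi> = hom_push g {0} {0, 1} (\<lambda>i\<in>{0}. 1) p \<Phi>})"

text \<open>On the equalizer, the push-forward along a map from \<^term>\<open>{0::int}\<close> to \<^term>\<open>I\<close> does not
  depend on the map; we use the one with value \<^term>\<open>Min I\<close>.\<close>

definition natural_map ::
    "('k, 'r) ring_scheme \<Rightarrow> ('k, 'o, 'm) globe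
      \<Rightarrow> int \<Rightarrow> ((int \<Rightarrow> 'o) \<Rightarrow> (int \<times> int \<Rightarrow> int \<times> 'm) \<Rightarrow> 'm)
      \<Rightarrow> int set \<Rightarrow> (unit \<Rightarrow> int \<times> (int set \<Rightarrow> 'k)) \<Rightarrow> (int \<Rightarrow> 'o) \<Rightarrow> (int \<times> int \<Rightarrow> int \<times> 'm) \<Rightarrow> 'm" where
  "natural_map R g p \<phi> =
     (\<lambda>I\<in>{I. ordinal I}. \<lambda>x\<in>pure (\<lambda>_. coOb (simplices R) I) [()].
        let q = fst (x ()); s = snd (x ()) in
        if q = 0 then aug R I s \<odot>\<^bsub>Deg (hom_at R g I) p\<^esub> hom_push g {0} I (\<lambda>i\<in>{0}. Min I) p \<phi>
        else \<zero>\<^bsub>Deg (hom_at R g I) (p + q)\<^esub>)"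

definition Hoch ::
    "('k, 'r) ring_scheme \<Rightarrow> ('k, 'o, 'm) dgcat \<Rightarrow> ('k, int set \<Rightarrow> (unit \<Rightarrow> int \<times> (int set \<Rightarrow> 'k))
      \<Rightarrow> (int \<Rightarrow> 'o) \<Rightarrow> (int \<times> int \<Rightarrow> int \<times> 'm) \<Rightarrow> 'm) cx" where
  "Hoch R A = Rhom R (A, A, id_fun A, id_fun A)"


section \<open>2-ordinals\<close>

record ord2 =
  tC :: "int set"
  tF :: "int \<times> int \<Rightarrow> int set"

definition is_ord2 :: "ord2 \<Rightarrow> bool" where
  "is_ord2 U \<longleftrightarrow> ordinal (tC U) \<and> (\<forall>c\<in>arrows (tC U). ordinal (tF U c)) \<and>
     (\<forall>c. c \<notin> arrows (tC U) \<longrightarrow> tF U c = {})"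

type_synonym cell = "(int \<times> int) \<times> (int \<times> int)"

definition cells :: "ord2 \<Rightarrow> cell set" where
  "cells U = (SIGMA c:arrows (tC U). arrows (tF U c))"

text \<open>The 2-cells in the order of composition. This is the chosen order of the factors in tensor
  products indexed by 2-cells.\<close>

definition cell_list :: "ord2 \<Rightarrow> cell list" where
  "cell_list U = concat (map (\<lambda>c. map (Pair c) (arrow_list (tF U c))) (arrow_list (tC U)))"

subsection \<open>The 2-category of a 2-ordinal\<close>

text \<open>The 1-arrows from \<^term>\<open>c\<close> to \<^term>\<open>c'\<close>. For \<^term>\<open>c = c'\<close> there is exactly one,
  namely \<^term>\<open>id2\<close>. There is a 2-arrow from \<^term>\<open>\<phi>\<close> to \<^term>\<open>\<psi>\<close> iff \<^term>\<open>le2 U c c' \<phi> \<psi>\<close>.\<close>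

type_synonym arr1 = "int \<times> int \<Rightarrow> int"

definition hom2 :: "ord2 \<Rightarrow> int \<Rightarrow> int \<Rightarrow> arr1 set" where
  "hom2 U c c' = (if c \<in> tC U \<and> c' \<in> tC U \<and> c \<le> c'
     then \<Pi>\<^sub>E a\<in>arrows (tC U \<inter> {c..c'}). tF U a else {})"

definition le2 :: "ord2 \<Rightarrow> int \<Rightarrow> int \<Rightarrow> arr1 \<Rightarrow> arr1 \<Rightarrow> bool" where
  "le2 U c c' \<phi> \<psi> \<longleftrightarrow> (\<forall>a\<in>arrows (tC U \<inter> {c..c'}). \<phi> a \<le> \<psi> a)"

definition least2 :: "ord2 \<Rightarrow> int \<Rightarrow> int \<Rightarrow> arr1" where
  "least2 U c c' = (\<lambda>a\<in>arrows (tC U \<inter> {c..c'}). Min (tF U a))"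

definition greatest2 :: "ord2 \<Rightarrow> int \<Rightarrow> int \<Rightarrow> arr1" where
  "greatest2 U c c' = (\<lambda>a\<in>arrows (tC U \<inter> {c..c'}). Max (tF U a))"

definition id2 :: arr1 where
  "id2 = (\<lambda>_. undefined)"

text \<open>Concatenation of $\varphi : c \to c'$ and $\psi : c' \to c''$.\<close>

definition cat2 :: "ord2 \<Rightarrow> int \<Rightarrow> int \<Rightarrow> int \<Rightarrow> arr1 \<Rightarrow> arr1 \<Rightarrow> arr1" where
  "cat2 U c c' c'' \<phi> \<psi> = (\<lambda>a\<in>arrows (tC U \<inter> {c..c''}). if snd a \<le> c' then \<phi> a else \<psi> a)"

subsection \<open>Maps of 2-ordinals\<close>

text \<open>A map $P : U \to V$ is the 2-functor $[P]$ in the opposite direction; as the categories of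
  1-arrows are posets, a 2-functor amounts to monotone maps compatible with identities and
  concatenation.\<close>

record map2 =
  pO :: "int \<Rightarrow> int"
  pM :: "int \<Rightarrow> int \<Rightarrow> arr1 \<Rightarrow> arr1"

definition is_map2 :: "ord2 \<Rightarrow> ord2 \<Rightarrow> map2 \<Rightarrow> bool" where
  "is_map2 U V P \<longleftrightarrow>
     is_ord2 U \<and> is_ord2 V \<and>
     dominant (tC V) (tC U) (pO P) \<and>
     (\<forall>c c'. pM P c c' \<in> extensional (hom2 V c c')) \<and>
     (\<forall>c\<in>tC V. \<forall>c'\<in>tC V.
        pM P c c' \<in> hom2 V c c' \<rightarrow> hom2 U (pO P c) (pO P c') \<and>
        (\<forall>\<phi>\<in>hom2 V c c'. \<forall>\<psi>\<in>hom2 V c c'.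
           le2 V c c' \<phi> \<psi> \<longrightarrow> le2 U (pO P c) (pO P c') (pM P c c' \<phi>) (pM P c c' \<psi>))) \<and>
     (\<forall>c\<in>tC V. pM P c c id2 = id2) \<and>
     (\<forall>c\<in>tC V. \<forall>c'\<in>tC V. \<forall>c''\<in>tC V. \<forall>\<phi>\<in>hom2 V c c'. \<forall>\<psi>\<in>hom2 V c' c''.
        pM P c c'' (cat2 V c c' c'' \<phi> \<psi>) =
        cat2 U (pO P c) (pO P c') (pO P c'') (pM P c c' \<phi>) (pM P c' c'' \<psi>)) \<and>
     (\<forall>c\<in>tC V. \<forall>c'\<in>tC V. c < c' \<longrightarrow>
        pM P c c' (least2 V c c') = least2 U (pO P c) (pO P c') \<and>
        pM P c c' (greatest2 V c c') = greatest2 U (pO P c) (pO P c'))"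

definition id_map2 :: "ord2 \<Rightarrow> map2" where
  "id_map2 U = \<lparr>pO = (\<lambda>c\<in>tC U. c), pM = (\<lambda>c c'. \<lambda>\<phi>\<in>hom2 U c c'. \<phi>)\<rparr>"

text \<open>\<^term>\<open>comp_map2 W Q P\<close> is $QP : U \to W$ for $P : U \to V$ and $Q : V \to W$.\<close>

definition comp_map2 :: "ord2 \<Rightarrow> map2 \<Rightarrow> map2 \<Rightarrow> map2" where
  "comp_map2 W Q P =
     \<lparr>pO = compose (tC W) (pO P) (pO Q),
      pM = (\<lambda>c c'. compose (hom2 W c c') (pM P (pO Q c) (pO Q c')) (pM Q c c'))\<rparr>"

definition inverse_maps2 :: "ord2 \<Rightarrow> ord2 \<Rightarrow> map2 \<Rightarrow> map2 \<Rightarrow> bool" where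
  "inverse_maps2 U V P P' \<longleftrightarrow> is_map2 U V P \<and> is_map2 V U P' \<and>
     comp_map2 U P' P = id_map2 U \<and> comp_map2 V P P' = id_map2 V"

definition iso2 :: "ord2 \<Rightarrow> ord2 \<Rightarrow> map2 \<Rightarrow> bool" where
  "iso2 U V P \<longleftrightarrow> (\<exists>P'. inverse_maps2 U V P P')"

definition inv2 :: "ord2 \<Rightarrow> ord2 \<Rightarrow> map2 \<Rightarrow> map2" where
  "inv2 U V P = (THE P'. inverse_maps2 U V P P')"

definition globe2 :: ord2 where
  "globe2 = \<lparr>tC = {0, 1}, tF = (\<lambda>_. {})((0, 1) := {0, 1})\<rparr>"

definition to_globe :: "ord2 \<Rightarrow> map2" where
  "to_globe U = (THE P. is_map2 U globe2 P)"

subsection \<open>Balls and preimages\<close>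

definition ball2 :: "ord2 \<Rightarrow> ord2 \<Rightarrow> bool" where
  "ball2 U' U \<longleftrightarrow> is_ord2 U' \<and> interval (tC U') (tC U) \<and>
     (\<forall>c\<in>arrows (tC U'). interval (tF U' c) (tF U c))"

definition cell_ball :: "cell \<Rightarrow> ord2" where
  "cell_ball = (\<lambda>((c, c'), (f, f')). \<lparr>tC = {c, c'}, tF = (\<lambda>_. {})((c, c') := {f, f'})\<rparr>)"

definition restrict2 :: "ord2 \<Rightarrow> map2 \<Rightarrow> map2" where
  "restrict2 V' P =
     \<lparr>pO = restrict (pO P) (tC V'), pM = (\<lambda>c c'. restrict (pM P c c') (hom2 V' c c'))\<rparr>"

definition preim :: "ord2 \<Rightarrow> map2 \<Rightarrow> ord2 \<Rightarrow> ord2" where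
  "preim U P V' = (THE U'. ball2 U' U \<and> is_map2 U' V' (restrict2 V' P))"

abbreviation cpre :: "ord2 \<Rightarrow> map2 \<Rightarrow> cell \<Rightarrow> ord2" where
  "cpre U P f \<equiv> preim U P (cell_ball f)"

text \<open>For an isomorphism $\varphi : U \to V$ the preimage of a 2-cell is a globe; this is its 2-cell.\<close>

definition iso_cell :: "ord2 \<Rightarrow> map2 \<Rightarrow> cell \<Rightarrow> cell" where
  "iso_cell U \<phi> f = the_elem (cells (cpre U \<phi> f))"


section \<open>2-operads\<close>

text \<open>The composition for $P : U \to V$ is an operation on families indexed by \<^term>\<open>Some f\<close> for
  the 2-cells \<^term>\<open>f\<close> of \<^term>\<open>V\<close> (the factors of $\mathcal O(P)$), in order, and then
  \<^term>\<open>None\<close> (the factor $\mathcal O(V)$).\<close>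

record ('k, 'p) operad2 =
  opOb :: "ord2 \<Rightarrow> ('k, 'p) cx"
  opIso :: "ord2 \<Rightarrow> ord2 \<Rightarrow> map2 \<Rightarrow> int \<Rightarrow> 'p \<Rightarrow> 'p"
  opComp :: "ord2 \<Rightarrow> ord2 \<Rightarrow> map2 \<Rightarrow> (cell option \<Rightarrow> int \<times> 'p) \<Rightarrow> 'p"

definition op_fam :: "('k, 'p) operad2 \<Rightarrow> ord2 \<Rightarrow> ord2 \<Rightarrow> map2 \<Rightarrow> cell option \<Rightarrow> ('k, 'p) cx" where
  "op_fam Op U V P = case_option (opOb Op V) (\<lambda>f. opOb Op (cpre U P f))"

definition op_list :: "ord2 \<Rightarrow> cell option list" where
  "op_list V = map Some (cell_list V) @ [None]"

definition op_args :: "ord2 \<Rightarrow> (cell \<Rightarrow> 'b) \<Rightarrow> 'b \<Rightarrow> cell option \<Rightarrow> 'b" where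
  "op_args V x y = restrict (case_option y x) (set (op_list V))"

definition hopComp ::
    "('k, 'p) operad2 \<Rightarrow> ord2 \<Rightarrow> ord2 \<Rightarrow> map2 \<Rightarrow> (cell option \<Rightarrow> int \<times> 'p) \<Rightarrow> int \<times> 'p" where
  "hopComp Op U V P a = (tdeg (op_list V) a, opComp Op U V P a)"

definition hopIso ::
    "('k, 'p) operad2 \<Rightarrow> ord2 \<Rightarrow> ord2 \<Rightarrow> map2 \<Rightarrow> int \<times> 'p \<Rightarrow> int \<times> 'p" where
  "hopIso Op U V \<phi> x = (fst x, opIso Op U V \<phi> (fst x) (snd x))"

text \<open>Equivariance: for $\alpha : U \cong U'$, $\beta : V \cong V'$ with $\beta P = P'\alpha$. The
  2-cell \<^term>\<open>f\<close> of $V'$ corresponds to \<^term>\<open>iso_cell V \<beta> f\<close> in $V$, and $\alpha$ restricts to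
  an isomorphism of the corresponding preimages.\<close>

definition op_equivariant :: "('k, 'p) operad2 \<Rightarrow> bool" where
  "op_equivariant Op \<longleftrightarrow> (\<forall>U V P U' V' P' \<alpha> \<beta>.
     is_map2 U V P \<and> is_map2 U' V' P' \<and> iso2 U U' \<alpha> \<and> iso2 V V' \<beta> \<and>
     comp_map2 V' \<beta> P = comp_map2 V' P' \<alpha> \<longrightarrow>
     (\<forall>a\<in>pure (op_fam Op U V P) (op_list V).
        hopIso Op U U' \<alpha> (hopComp Op U V P a) =
        hopComp Op U' V' P' (op_args V'
          (\<lambda>f. hopIso Op (cpre U P (iso_cell V \<beta> f)) (cpre U' P' f) (restrict2 (cpre U' P' f) \<alpha>)
                 (a (Some (iso_cell V \<beta> f))))
          (hopIso Op V V' \<beta> (a None)))))"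

text \<open>Associativity for $U \to V \to W \to X$ is an equality of maps
  $\mathcal O(P)\otimes\mathcal O(Q)\otimes\mathcal O(R)\to\mathcal O(RQP)$ between tensor products
  over the 2-cells of $X$, which is the tensor product of the corresponding equalities for the
  restrictions to the preimages of the 2-cells of $X$. So it is stated for $X$ a globe, where
  $\mathcal O(R) = \mathcal O(W)$ and $\mathcal O(RQP) = \mathcal O(U)$; the sign is the one of the
  reordering
  $\bigotimes_f x_f\otimes\bigotimes_g y_g \mapsto \bigotimes_g(\bigotimes_{f\in Q^{-1}g} x_f\otimes y_g)$.\<close>

definition op_associative :: "('k, 'p) operad2 \<Rightarrow> bool" where
  "op_associative Op \<longleftrightarrow> (\<forall>U V W P Q.
     is_map2 U V P \<and> is_map2 V W Q \<longrightarrow>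
     (\<forall>x\<in>\<Pi>\<^sub>E f\<in>cells V. hel (opOb Op (cpre U P f)).
      \<forall>y\<in>\<Pi>\<^sub>E g\<in>cells W. hel (opOb Op (cpre V Q g)).
      \<forall>z\<in>hel (opOb Op W).
        let QP = comp_map2 W Q P;
            lhs = hopComp Op U V P (op_args V x (hopComp Op V W Q (op_args W y z)));
            rhs = hopComp Op U W QP (op_args W
                    (\<lambda>g. hopComp Op (cpre U QP g) (cpre V Q g) (restrict2 (cpre V Q g) P)
                           (op_args (cpre V Q g) x (y g))) z);
            e = kosz (case_sum (fst \<circ> x) (fst \<circ> y))
                  (map Inl (cell_list V) @ map Inr (cell_list W))
                  (concat (map (\<lambda>g. map Inl (cell_list (cpre V Q g)) @ [Inr g]) (cell_list W)))
        in fst lhs = fst rhs \<and> snd lhs = sgm (Deg (opOb Op U) (fst rhs)) e (snd rhs)))"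

definition two_operad :: "('k, 'r) ring_scheme \<Rightarrow> ('k, 'p) operad2 \<Rightarrow> bool" where
  "two_operad R Op \<longleftrightarrow>
     (\<forall>U. is_ord2 U \<longrightarrow> is_cx R (opOb Op U)) \<and>
     (\<forall>U V \<phi>. iso2 U V \<phi> \<longrightarrow> chain_map R (opOb Op U) (opOb Op V) (opIso Op U V \<phi>)) \<and>
     (\<forall>U. is_ord2 U \<longrightarrow> (\<forall>x\<in>hel (opOb Op U). hopIso Op U U (id_map2 U) x = x)) \<and>
     (\<forall>U V W \<phi> \<psi>. iso2 U V \<phi> \<and> iso2 V W \<psi> \<longrightarrow> (\<forall>x\<in>hel (opOb Op U).
        hopIso Op U W (comp_map2 W \<psi> \<phi>) x = hopIso Op V W \<psi> (hopIso Op U V \<phi> x))) \<and>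
     (\<forall>U V P. is_map2 U V P \<longrightarrow>
        mchain R (op_fam Op U V P) (op_list V) (opOb Op U) (opComp Op U V P)) \<and>
     op_equivariant Op \<and> op_associative Op"

definition operad_map ::
    "('k, 'r) ring_scheme \<Rightarrow> ('k, 'p) operad2 \<Rightarrow> ('k, 'q) operad2 \<Rightarrow> (ord2 \<Rightarrow> int \<Rightarrow> 'p \<Rightarrow> 'q) \<Rightarrow> bool" where
  "operad_map R Op Op' \<theta> \<longleftrightarrow>
     (\<forall>U. is_ord2 U \<longrightarrow> chain_map R (opOb Op U) (opOb Op' U) (\<theta> U)) \<and>
     (\<forall>U V \<phi>. iso2 U V \<phi> \<longrightarrow> (\<forall>(n, x)\<in>hel (opOb Op U).
        \<theta> V n (opIso Op U V \<phi> n x) = opIso Op' U V \<phi> n (\<theta> U n x))) \<and>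
     (\<forall>U V P. is_map2 U V P \<longrightarrow> (\<forall>a\<in>pure (op_fam Op U V P) (op_list V).
        \<theta> U (tdeg (op_list V) a) (opComp Op U V P a) =
        opComp Op' U V P (op_args V
          (\<lambda>f. (fst (a (Some f)), \<theta> (cpre U P f) (fst (a (Some f))) (snd (a (Some f)))))
          (fst (a None), \<theta> V (fst (a None)) (snd (a None))))))"

definition triv :: "('k, 'r) ring_scheme \<Rightarrow> ('k, 'k) operad2" where
  "triv R =
     \<lparr>opOb = (\<lambda>_. ground_cx R),
      opIso = (\<lambda>_ _ _ _ r. r),
      opComp = (\<lambda>U V P a. \<Otimes>\<^bsub>R\<^esub> i\<in>set (op_list V). snd (a i))\<rparr>"

definition contractible ::
    "('k, 'r) ring_scheme \<Rightarrow> ('k, 'p) operad2 \<Rightarrow> (ord2 \<Rightarrow> int \<Rightarrow> 'p \<Rightarrow> 'k) \<Rightarrow> bool" where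
  "contractible R Op \<epsilon> \<longleftrightarrow> two_operad R Op \<and> operad_map R Op (triv R) \<epsilon> \<and>
     (\<forall>U. is_ord2 U \<longrightarrow> quasi_iso R (opOb Op U) (opOb (triv R) U) (\<epsilon> U))"


section \<open>Algebras\<close>

subsection \<open>Diagrams\<close>

record ('k, 'o, 'm) diagram =
  dO :: "int \<Rightarrow> ('k, 'o, 'm) dgcat"
  dM :: "int \<Rightarrow> int \<Rightarrow> arr1 \<Rightarrow> ('o, 'm) dgfun"

definition diagrams :: "('k, 'o, 'm) subcat \<Rightarrow> ord2 \<Rightarrow> ('k, 'o, 'm) diagram set" where
  "diagrams C U = {D.
     dO D \<in> tC U \<rightarrow>\<^sub>E cOb C \<and>
     (\<forall>c c'. dM D c c' \<in> extensional (hom2 U c c')) \<and>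
     (\<forall>c\<in>tC U. \<forall>c'\<in>tC U. dM D c c' \<in> hom2 U c c' \<rightarrow> cAr C (dO D c) (dO D c')) \<and>
     (\<forall>c\<in>tC U. dM D c c id2 = id_fun (dO D c)) \<and>
     (\<forall>c\<in>tC U. \<forall>c'\<in>tC U. \<forall>c''\<in>tC U. \<forall>\<phi>\<in>hom2 U c c'. \<forall>\<psi>\<in>hom2 U c' c''.
        dM D c c'' (cat2 U c c' c'' \<phi> \<psi>) = comp_fun (dO D c) (dM D c' c'' \<psi>) (dM D c c' \<phi>))}"

definition push_diag :: "ord2 \<Rightarrow> map2 \<Rightarrow> ('k, 'o, 'm) diagram \<Rightarrow> ('k, 'o, 'm) diagram" where
  "push_diag V P D =
     \<lparr>dO = compose (tC V) (dO D) (pO P),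
      dM = (\<lambda>c c'. compose (hom2 V c c') (dM D (pO P c) (pO P c')) (pM P c c'))\<rparr>"

definition restrict_diag :: "ord2 \<Rightarrow> ('k, 'o, 'm) diagram \<Rightarrow> ('k, 'o, 'm) diagram" where
  "restrict_diag U' D =
     \<lparr>dO = restrict (dO D) (tC U'), dM = (\<lambda>c c'. restrict (dM D c c') (hom2 U' c c'))\<rparr>"

definition const_diag :: "('k, 'o, 'm) dgcat \<Rightarrow> ord2 \<Rightarrow> ('k, 'o, 'm) diagram" where
  "const_diag A U = \<lparr>dO = (\<lambda>c\<in>tC U. A), dM = (\<lambda>c c'. \<lambda>\<phi>\<in>hom2 U c c'. id_fun A)\<rparr>"

text \<open>The globe given by a diagram over a 2-ordinal \<^term>\<open>G\<close> that is a globe.\<close>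

definition globe_of :: "ord2 \<Rightarrow> ('k, 'o, 'm) diagram \<Rightarrow> ('k, 'o, 'm) globe" where
  "globe_of G D =
     (let c = Min (tC G); c' = Max (tC G) in
      (dO D c, dO D c', dM D c c' (least2 G c c'), dM D c c' (greatest2 G c c')))"

definition in_globe :: "('k, 'o, 'm) diagram \<Rightarrow> cell \<Rightarrow> ('k, 'o, 'm) globe" where
  "in_globe D f = globe_of (cell_ball f) (restrict_diag (cell_ball f) D)"

definition out_globe :: "ord2 \<Rightarrow> ('k, 'o, 'm) diagram \<Rightarrow> ('k, 'o, 'm) globe" where
  "out_globe U D = globe_of globe2 (push_diag globe2 (to_globe U) D)"

subsection \<open>Endomorphism 2-operads\<close>

text \<open>Insertion of the operations \<^term>\<open>a (Some f)\<close> into \<^term>\<open>a None\<close>, evaluated at \<^term>\<open>h\<close>.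
  The sign is the Koszul sign of
  $\bigotimes_f \alpha_f\otimes\beta\otimes\bigotimes_g h_g \mapsto
   \beta\otimes\bigotimes_f(\alpha_f\otimes\bigotimes_{g\in P^{-1}f} h_g)$.\<close>

definition insert_op ::
    "('k, 'x) cx \<Rightarrow> ord2 \<Rightarrow> ord2 \<Rightarrow> map2 \<Rightarrow> (cell option \<Rightarrow> int \<times> ((cell \<Rightarrow> int \<times> 'x) \<Rightarrow> 'x))
      \<Rightarrow> (cell \<Rightarrow> int \<times> 'x) \<Rightarrow> 'x" where
  "insert_op N U V P a h =
     (let r = (\<lambda>f\<in>cells V. let u = restrict h (cells (cpre U P f)) in
                (fst (a (Some f)) + tdeg (cell_list (cpre U P f)) u, snd (a (Some f)) u));
          e = kosz (case_sum (fst \<circ> a) (fst \<circ> h))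
                (map Inl (op_list V) @ map Inr (cell_list U))
                (Inl None #
                  concat (map (\<lambda>f. Inl (Some f) # map Inr (cell_list (cpre U P f))) (cell_list V)))
      in sgm (Deg N (tdeg (op_list V) a + tdeg (cell_list U) h)) e (snd (a None) r))"

definition full1 :: "('k, 'r) ring_scheme \<Rightarrow> ('k, 'x) cx \<Rightarrow> ('k, (cell \<Rightarrow> int \<times> 'x) \<Rightarrow> 'x) operad2" where
  "full1 R K =
     \<lparr>opOb = (\<lambda>U. hom_cx R (\<lambda>_. K) (cell_list U) K),
      opIso = (\<lambda>U V \<phi> n \<alpha>. \<lambda>h\<in>pure (\<lambda>_. K) (cell_list V).
        \<alpha> (\<lambda>g\<in>cells U. h (iso_cell V (inv2 U V \<phi>) g))),
      opComp = (\<lambda>U V P a. \<lambda>h\<in>pure (\<lambda>_. K) (cell_list U). insert_op K U V P a h)\<rparr>"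

abbreviation diag_fam ::
    "(('k, 'o, 'm) globe \<Rightarrow> ('k, 'x) cx) \<Rightarrow> ('k, 'o, 'm) diagram \<Rightarrow> cell \<Rightarrow> ('k, 'x) cx" where
  "diag_fam K D \<equiv> (\<lambda>f. K (in_globe D f))"

definition full ::
    "('k, 'r) ring_scheme \<Rightarrow> ('k, 'o, 'm) subcat \<Rightarrow> (('k, 'o, 'm) globe \<Rightarrow> ('k, 'x) cx)
      \<Rightarrow> ('k, ('k, 'o, 'm) diagram \<Rightarrow> (cell \<Rightarrow> int \<times> 'x) \<Rightarrow> 'x) operad2" where
  "full R C K =
     \<lparr>opOb = (\<lambda>U. prod_cx (diagrams C U) (\<lambda>D.
        hom_cx R (diag_fam K D) (cell_list U) (K (out_globe U D)))),
      opIso = (\<lambda>U V \<phi> n \<alpha>. \<lambda>D\<in>diagrams C V. \<lambda>h\<in>pure (diag_fam K D) (cell_list V).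
        \<alpha> (push_diag U (inv2 U V \<phi>) D) (\<lambda>g\<in>cells U. h (iso_cell V (inv2 U V \<phi>) g))),
      opComp = (\<lambda>U V P a. \<lambda>D\<in>diagrams C U. \<lambda>h\<in>pure (diag_fam K D) (cell_list U).
        insert_op (K (out_globe U D)) U V P
          (case_option
             (fst (a None), snd (a None) (push_diag V P D))
             (\<lambda>f. (fst (a (Some f)), snd (a (Some f)) (restrict_diag (cpre U P f) D)))) h)\<rparr>"

definition algebra2 ::
    "('k, 'r) ring_scheme \<Rightarrow> ('k, 'o, 'm) subcat \<Rightarrow> ('k, 'p) operad2
      \<Rightarrow> (('k, 'o, 'm) globe \<Rightarrow> ('k, 'x) cx)
      \<Rightarrow> (ord2 \<Rightarrow> int \<Rightarrow> 'p \<Rightarrow> ('k, 'o, 'm) diagram \<Rightarrow> (cell \<Rightarrow> int \<times> 'x) \<Rightarrow> 'x) \<Rightarrow> bool" where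
  "algebra2 R C Op K \<mu> \<longleftrightarrow> operad_map R Op (full R C K) \<mu>"

definition single_algebra2 ::
    "('k, 'r) ring_scheme \<Rightarrow> ('k, 'p) operad2 \<Rightarrow> ('k, 'x) cx
      \<Rightarrow> (ord2 \<Rightarrow> int \<Rightarrow> 'p \<Rightarrow> (cell \<Rightarrow> int \<times> 'x) \<Rightarrow> 'x) \<Rightarrow> bool" where
  "single_algebra2 R Op K \<mu> \<longleftrightarrow> operad_map R Op (full1 R K) \<mu>"

definition algebra2_map ::
    "('k, 'r) ring_scheme \<Rightarrow> ('k, 'o, 'm) subcat \<Rightarrow> ('k, 'p) operad2
      \<Rightarrow> (('k, 'o, 'm) globe \<Rightarrow> ('k, 'x) cx)
      \<Rightarrow> (ord2 \<Rightarrow> int \<Rightarrow> 'p \<Rightarrow> ('k, 'o, 'm) diagram \<Rightarrow> (cell \<Rightarrow> int \<times> 'x) \<Rightarrow> 'x)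
      \<Rightarrow> (('k, 'o, 'm) globe \<Rightarrow> ('k, 'y) cx)
      \<Rightarrow> (ord2 \<Rightarrow> int \<Rightarrow> 'p \<Rightarrow> ('k, 'o, 'm) diagram \<Rightarrow> (cell \<Rightarrow> int \<times> 'y) \<Rightarrow> 'y)
      \<Rightarrow> (('k, 'o, 'm) globe \<Rightarrow> int \<Rightarrow> 'x \<Rightarrow> 'y) \<Rightarrow> bool" where
  "algebra2_map R C Op K \<mu> L \<nu> \<theta> \<longleftrightarrow>
     (\<forall>g\<in>globes C. chain_map R (K g) (L g) (\<theta> g)) \<and>
     (\<forall>U. is_ord2 U \<longrightarrow> (\<forall>D\<in>diagrams C U. \<forall>(n, x)\<in>hel (opOb Op U).
        \<forall>h\<in>pure (diag_fam K D) (cell_list U).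
          \<theta> (out_globe U D) (n + tdeg (cell_list U) h) (\<mu> U n x D h) =
          \<nu> U n x D (\<lambda>f\<in>cells U. (fst (h f), \<theta> (in_globe D f) (fst (h f)) (snd (h f))))))"

subsection \<open>The standard algebra structure on naive natural transformations\<close>

text \<open>A naive natural transformation, as an element of $\mathbf{hom}^{[0]}(F,G)$, has the component
  \<^term>\<open>component \<phi> y\<close> at the object \<^term>\<open>y\<close>.\<close>

definition component ::
    "int \<times> ((int \<Rightarrow> 'o) \<Rightarrow> (int \<times> int \<Rightarrow> int \<times> 'm) \<Rightarrow> 'm) \<Rightarrow> 'o \<Rightarrow> int \<times> 'm" where
  "component \<phi> y = (fst \<phi>, snd \<phi> (\<lambda>i\<in>{0}. y) (\<lambda>_. undefined))"

abbreviation gen_arr :: "('k, 'o, 'm) diagram \<Rightarrow> int \<times> int \<Rightarrow> int \<Rightarrow> ('o, 'm) dgfun" where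
  "gen_arr D c f \<equiv> dM D (fst c) (snd c) (\<lambda>a\<in>{c}. f)"

text \<open>\<^term>\<open>vert D c h f0 fs y\<close> is the component at \<^term>\<open>y\<close> of the vertical composite of the
  natural transformations assigned by \<^term>\<open>h\<close> to the consecutive 2-cells \<^term>\<open>fs\<close>
  (last one first) over the arrow \<^term>\<open>c\<close>, starting at \<^term>\<open>f0\<close>.\<close>

fun vert ::
    "('k, 'o, 'm) diagram \<Rightarrow> int \<times> int
      \<Rightarrow> (cell \<Rightarrow> int \<times> ((int \<Rightarrow> 'o) \<Rightarrow> (int \<times> int \<Rightarrow> int \<times> 'm) \<Rightarrow> 'm))
      \<Rightarrow> int \<Rightarrow> (int \<times> int) list \<Rightarrow> 'o \<Rightarrow> int \<times> 'm" where
  "vert D c h f0 [] y = (0, idn (dO D (snd c)) (fO (gen_arr D c f0) y))"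
| "vert D c h f0 ((f, f') # fs) y =
     hcmp (dO D (snd c)) (fO (gen_arr D c f0) y) (fO (gen_arr D c f) y) (fO (gen_arr D c f') y)
       (component (h (c, (f, f'))) y) (vert D c h f0 fs y)"

text \<open>Horizontal composition over consecutive arrows \<^term>\<open>cs\<close> (last one first) starting at
  the minimum, at the object \<^term>\<open>x\<close>, by
  $(\vartheta * \tau)_x = \vartheta_{G x}\circ F'(\tau_x)$ for $\tau : F \to G$ and
  $\vartheta : F' \to G'$. As the 2-cells are ordered by composition, no signs occur.\<close>

fun horz ::
    "ord2 \<Rightarrow> ('k, 'o, 'm) diagram
      \<Rightarrow> (cell \<Rightarrow> int \<times> ((int \<Rightarrow> 'o) \<Rightarrow> (int \<times> int \<Rightarrow> int \<times> 'm) \<Rightarrow> 'm))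
      \<Rightarrow> 'o \<Rightarrow> (int \<times> int) list \<Rightarrow> int \<times> 'm" where
  "horz U D h x [] = (0, idn (dO D (Min (tC U))) x)"
| "horz U D h x (c # cs) =
     (let m = Min (tC U); c0 = fst c;
          w = fO (dM D m c0 (least2 U m c0)) x; y = fO (dM D m c0 (greatest2 U m c0)) x;
          F = gen_arr D c (Min (tF U c)); G = gen_arr D c (Max (tF U c))
      in hcmp (dO D (snd c)) (fO F w) (fO F y) (fO G y)
           (vert D c h (Min (tF U c)) (arrow_list (tF U c)) y)
           (hmap F w y (horz U D h x cs)))"

definition std_op ::
    "('k, 'r) ring_scheme \<Rightarrow> ('k, 'o, 'm) subcat \<Rightarrow> ord2 \<Rightarrow> ('k, 'o, 'm) diagram
      \<Rightarrow> (cell \<Rightarrow> int \<times> ((int \<Rightarrow> 'o) \<Rightarrow> (int \<times> int \<Rightarrow> int \<times> 'm) \<Rightarrow> 'm))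
      \<Rightarrow> (int \<Rightarrow> 'o) \<Rightarrow> (int \<times> int \<Rightarrow> int \<times> 'm) \<Rightarrow> 'm" where
  "std_op R C U =
     (\<lambda>D\<in>diagrams C U. \<lambda>h\<in>pure (diag_fam (naive_hom R) D) (cell_list U).
        \<lambda>X\<in>{0} \<rightarrow>\<^sub>E Ob (dO D (Min (tC U))). \<lambda>u\<in>extensional {}.
          snd (horz U D h (X 0) (arrow_list (tC U))))"

definition std_alg ::
    "('k, 'r) ring_scheme \<Rightarrow> ('k, 'o, 'm) subcat \<Rightarrow> ord2 \<Rightarrow> int \<Rightarrow> 'k \<Rightarrow> ('k, 'o, 'm) diagram
      \<Rightarrow> (cell \<Rightarrow> int \<times> ((int \<Rightarrow> 'o) \<Rightarrow> (int \<times> int \<Rightarrow> int \<times> 'm) \<Rightarrow> 'm))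
      \<Rightarrow> (int \<Rightarrow> 'o) \<Rightarrow> (int \<times> int \<Rightarrow> int \<times> 'm) \<Rightarrow> 'm" where
  "std_alg R C U n r =
     (let M = Deg (opOb (full R C (naive_hom R)) U) n
      in if n = 0 then r \<odot>\<^bsub>M\<^esub> std_op R C U else \<zero>\<^bsub>M\<^esub>)"

end

theory Submission
  imports Defs
begin

text \<open>Push-forwards along maps and restrictions to balls of constant diagrams are constant, and both
  the 2-cells and the boundary of a constant diagram are the globe \<open>(A, A, id, id)\<close>. Hence the
  components at constant diagrams define a map from the endomorphism 2-operad of a
  \<open>C\<close>-complex to that of the single complex it assigns to this globe, and composition
  with it gives the induced structure. What has to be checked is that the 2-ordinals and maps
  specified by definite descriptions (terminal maps, inverses, preimages of 2-cells) exist and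
  are unique.\<close>

section \<open>Intervals and arrows\<close>

lemma arrows_interval_subset: "arrows (I \<inter> {a..b}) \<subseteq> arrows I"
  by (fastforce simp: arrows_def)

lemma arrows_singleton [simp]: "arrows {c} = {}"
  by (auto simp: arrows_def)

lemma arrows_pair: "c < c' \<Longrightarrow> arrows {c, c'} = {(c, c')}"
  by (auto simp: arrows_def)

lemma int_singleton_interval: "c \<in> I \<Longrightarrow> I \<inter> {c..c} = {c}" for c :: int
  by auto

lemma arrow_interval: "(c, c') \<in> arrows I \<Longrightarrow> I \<inter> {c..c'} = {c, c'}"
  by (force simp: arrows_def)

lemma arrows_insert_less:
  assumes "y \<in> I" "\<And>z. z \<in> I \<Longrightarrow> x < z" "\<And>z. z \<in> I \<Longrightarrow> y \<le> z"
  shows "arrows (insert x I) = insert (x, y) (arrows I)"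
proof (intro equalityI subsetI)
  fix a assume a: "a \<in> arrows (insert x I)"
  obtain i j where [simp]: "a = (i, j)"
    by (cases a)
  have "j \<in> I" "i \<noteq> x \<Longrightarrow> i \<in> I"
    using a assms by (force simp: arrows_def)+
  moreover have "i = x \<Longrightarrow> j = y"
    using a assms \<open>j \<in> I\<close> by (force simp: arrows_def)
  ultimately show "a \<in> insert (x, y) (arrows I)"
    using a by (cases "i = x") (auto simp: arrows_def)
next
  fix a assume "a \<in> insert (x, y) (arrows I)"
  then show "a \<in> arrows (insert x I)"
    using assms by (force simp: arrows_def)
qed

text \<open>Induction along the sorted list: prepending a smaller element puts one new pair at the
  front of the zip, and by \<open>arrows_insert_less\<close> this is the one new arrow.\<close>

lemma set_arrow_list:
  assumes "finite I"
  shows "set (arrow_list I) = arrows I"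
proof -
  define xs where "xs = sorted_list_of_set I"
  have s: "sorted_wrt (<) xs" and I: "set xs = I"
    using assms by (auto simp: xs_def)
  have "set (zip xs (tl xs)) = arrows (set xs)"
    using s
  proof (induction xs)
    case (Cons x xs)
    show ?case
    proof (cases xs)
      case (Cons y ys)
      have "arrows (set (x # xs)) = insert (x, y) (arrows (set xs))"
        unfolding list.set(2)[of x xs]
        by (rule arrows_insert_less) (use Cons.prems \<open>xs = y # ys\<close> in auto)
      then show ?thesis
        using Cons.IH Cons.prems \<open>xs = y # ys\<close> by simp
    qed (simp add: arrows_def)
  qed (simp add: arrows_def)
  then show ?thesis
    by (simp add: arrow_list_def Let_def I flip: xs_def)
qed

text \<open>Used to see that the 1-arrows between two objects of a ball and those of the ambient
  2-ordinal are families over the same index set.\<close>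

lemma interval_restrict:
  assumes "interval J I" "a \<in> J" "b \<in> J"
  shows "J \<inter> {a..b} = I \<inter> {a..b}"
  using assms by (auto simp: interval_def)

text \<open>An interval is recovered from its end points; this is what makes preimages of 2-cells
  unique.\<close>

lemma interval_Min_Max:
  assumes "interval J I" "finite I"
  shows "J = I \<inter> {Min J..Max J}"
proof -
  from assms(1) obtain a b where ab: "a \<in> I" "b \<in> I" "a \<le> b" "J = I \<inter> {a..b}"
    by (auto simp: interval_def)
  have "Min J = a" "Max J = b"
    using ab assms(2) by (auto intro!: Min_eqI Max_eqI)
  then show ?thesis using ab by simp
qed

lemma Min_interval: "\<lbrakk>a \<in> I; b \<in> I; a \<le> b; finite I\<rbrakk> \<Longrightarrow> Min (I \<inter> {a..b}) = a" for a :: int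
  by (rule Min_eqI) auto

lemma Max_interval: "\<lbrakk>a \<in> I; b \<in> I; a \<le> b; finite I\<rbrakk> \<Longrightarrow> Max (I \<inter> {a..b}) = b" for a :: int
  by (rule Max_eqI) auto

lemma ordinal_Min_Max:
  assumes "ordinal I"
  shows "Min I \<in> I" "Max I \<in> I" "Min I \<le> Max I" "I \<inter> {Min I..Max I} = I"
  using assms by (auto simp: ordinal_def)

lemma arrowsD: "(c, c') \<in> arrows I \<Longrightarrow> c \<in> I \<and> c' \<in> I \<and> c < c'"
  by (auto simp: arrows_def)


section \<open>The 2-category of a 2-ordinal\<close>

lemma set_cell_list:
  assumes "is_ord2 U"
  shows "set (cell_list U) = cells U"
  using assms by (force simp: cell_list_def cells_def is_ord2_def ordinal_def set_arrow_list)

lemma set_op_list: "is_ord2 V \<Longrightarrow> set (op_list V) = insert None (Some ` cells V)"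
  by (auto simp: op_list_def set_cell_list)

lemma hom2_id2: "c \<in> tC U \<Longrightarrow> hom2 U c c = {id2}"
  by (auto simp: hom2_def int_singleton_interval id2_def)

lemma hom2D: "\<phi> \<in> hom2 U c c' \<Longrightarrow> c \<in> tC U \<and> c' \<in> tC U \<and> c \<le> c'"
  by (auto simp: hom2_def split: if_splits)

lemma least2_greatest2_in_hom2:
  assumes "is_ord2 U" "c \<in> tC U" "c' \<in> tC U" "c \<le> c'"
  shows "least2 U c c' \<in> hom2 U c c'" "greatest2 U c c' \<in> hom2 U c c'"
  using assms arrows_interval_subset[of "tC U" c c']
  by (auto simp: hom2_def least2_def greatest2_def is_ord2_def subset_iff
      intro!: ordinal_Min_Max(1,2))

lemma cat2_in_hom2:
  assumes "\<phi> \<in> hom2 U c c'" "\<psi> \<in> hom2 U c' c''"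
  shows "cat2 U c c' c'' \<phi> \<psi> \<in> hom2 U c c''"
proof -
  note c = hom2D[OF assms(1)] hom2D[OF assms(2)]
  have "cat2 U c c' c'' \<phi> \<psi> a \<in> tF U a" if a: "a \<in> arrows (tC U \<inter> {c..c''})" for a
  proof (cases "snd a \<le> c'")
    case True
    then have "a \<in> arrows (tC U \<inter> {c..c'})"
      using a by (auto simp: arrows_def)
    then show ?thesis
      using True a assms(1) c by (auto simp: cat2_def hom2_def)
  next
    case False
    \<comment> \<open>No arrow straddles \<open>c'\<close>: as an element of the ordinal,
      \<open>c'\<close> cannot lie strictly between the source and the target of
      \<open>a\<close>.\<close>
    then have "\<not> fst a < c'"
      using a c by (auto simp: arrows_def)
    then have "c' \<le> fst a"
      by simp
    then have "a \<in> arrows (tC U \<inter> {c'..c''})"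
      using a c by (auto simp: arrows_def)
    then show ?thesis
      using False a assms(2) c by (auto simp: cat2_def hom2_def)
  qed
  then show ?thesis
    using c by (auto simp: hom2_def cat2_def)
qed

text \<open>\<open>cat2\<close> consults its first argument only at arrows ending at or before
  \<open>c\<close>, and no arrow over [c, c'] does.\<close>

lemma cat2_id2_left:
  assumes "\<psi> \<in> hom2 U c c'"
  shows "cat2 U c c c' \<phi> \<psi> = \<psi>"
proof
  fix a
  have "\<not> snd a \<le> c" if "a \<in> arrows (tC U \<inter> {c..c'})"
    using that by (auto simp: arrows_def)
  then show "cat2 U c c c' \<phi> \<psi> a = \<psi> a"
    using assms hom2D[OF assms] by (cases a) (auto simp: cat2_def hom2_def PiE_iff extensional_def)
qed

lemma cat2_id2_right:
  assumes "\<phi> \<in> hom2 U c c'"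
  shows "cat2 U c c' c' \<phi> \<psi> = \<phi>"
proof
  fix a
  have "snd a \<le> c'" if "a \<in> arrows (tC U \<inter> {c..c'})"
    using that by (auto simp: arrows_def)
  then show "cat2 U c c' c' \<phi> \<psi> a = \<phi> a"
    using assms hom2D[OF assms] by (cases a) (auto simp: cat2_def hom2_def PiE_iff extensional_def)
qed

text \<open>By \<open>interval_restrict\<close> both sides are products over the same arrows, and
  the factors for the ball are contained in the others. Hence functors and diagrams restrict to
  balls without changing any value.\<close>

lemma ball2_hom2_subset:
  assumes "ball2 U' U"
  shows "hom2 U' c c' \<subseteq> hom2 U c c'"
proof
  fix \<phi> assume \<phi>: "\<phi> \<in> hom2 U' c c'"
  note c = hom2D[OF \<phi>]
  have sub: "tC U' \<subseteq> tC U"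
    using assms by (auto simp: ball2_def interval_def)
  have eq: "tC U' \<inter> {c..c'} = tC U \<inter> {c..c'}"
    using assms c by (intro interval_restrict) (auto simp: ball2_def)
  have "tF U' a \<subseteq> tF U a" if "a \<in> arrows (tC U \<inter> {c..c'})" for a
    using that arrows_interval_subset[of "tC U'" c c'] assms
    unfolding ball2_def eq by (auto simp: interval_def)
  then show "\<phi> \<in> hom2 U c c'"
    using \<phi> c sub by (auto simp: hom2_def eq PiE_iff subset_iff)
qed


section \<open>Maps to globes\<close>

context
  fixes c c' f f' :: int and G :: ord2
  assumes lt: "c < c'" "f < f'"
  defines "G \<equiv> cell_ball ((c, c'), (f, f'))"
begin

lemma tC_cell_ball: "tC G = {c, c'}"
  by (simp add: G_def cell_ball_def)

lemma tF_cell_ball: "tF G (c, c') = {f, f'}"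
  by (simp add: G_def cell_ball_def)

lemma is_ord2_cell_ball: "is_ord2 G"
  using lt by (auto simp: G_def cell_ball_def is_ord2_def ordinal_def arrows_pair)

lemma cell_ball_inter: "{c, c'} \<inter> {c..c'} = {c, c'}"
  using lt by auto

lemma least2_cell_ball: "least2 G c c' = (\<lambda>a\<in>{(c, c')}. f)"
  unfolding least2_def tC_cell_ball cell_ball_inter arrows_pair[OF lt(1)]
  by (rule restrict_ext) (use lt in \<open>simp add: tF_cell_ball\<close>)

lemma greatest2_cell_ball: "greatest2 G c c' = (\<lambda>a\<in>{(c, c')}. f')"
  unfolding greatest2_def tC_cell_ball cell_ball_inter arrows_pair[OF lt(1)]
  by (rule restrict_ext) (use lt in \<open>simp add: tF_cell_ball\<close>)

lemma hom2_cell_ball: "hom2 G c c' = {least2 G c c', greatest2 G c c'}"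
proof -
  have "hom2 G c c' = Pi\<^sub>E {(c, c')} (tF G)"
    unfolding hom2_def tC_cell_ball cell_ball_inter arrows_pair[OF lt(1)] using lt by simp
  also have "\<dots> = (\<Union>b\<in>{f, f'}. {\<lambda>a\<in>{(c, c')}. b})"
    unfolding PiE_over_singleton_iff tF_cell_ball ..
  also have "\<dots> = {least2 G c c', greatest2 G c c'}"
    unfolding least2_cell_ball greatest2_cell_ball by blast
  finally show ?thesis .
qed

lemma hom2_cell_ball_cases:
  assumes "\<phi> \<in> hom2 G x y"
  obtains "x = c" "y = c" "\<phi> = id2" | "x = c'" "y = c'" "\<phi> = id2"
    | "x = c" "y = c'" "\<phi> = least2 G c c'" | "x = c" "y = c'" "\<phi> = greatest2 G c c'"
proof -
  have "x \<in> {c, c'}" "y \<in> {c, c'}" "x \<le> y"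
    using hom2D[OF assms] by (auto simp: tC_cell_ball)
  then consider "x = c" "y = c" | "x = c'" "y = c'" | "x = c" "y = c'"
    using lt by auto
  then show thesis
    using assms that hom2_cell_ball hom2_id2[of c G] hom2_id2[of c' G]
    by cases (auto simp: tC_cell_ball)
qed

text \<open>Serves twice: it excludes the reverse relation when monotonicity is checked, and it
  shows that the two boundary 1-arrows are distinct.\<close>

lemma not_greatest2_le2_least2_cell_ball: "\<not> le2 G c c' (greatest2 G c c') (least2 G c c')"
  using lt by (simp add: le2_def least2_cell_ball greatest2_cell_ball tC_cell_ball cell_ball_inter
      arrows_pair)

text \<open>Dominance and preservation of least and greatest elements prescribe the values of a
  2-functor out of [G]. Conversely these values always form a map, because [G] has one non-trivial
  2-arrow and no composable pair of non-identity 1-arrows.\<close>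

lemma is_map2_cell_ball_iff:
  "is_map2 U G P \<longleftrightarrow>
     is_ord2 U \<and> pO P \<in> extensional {c, c'} \<and> pO P c = Min (tC U) \<and> pO P c' = Max (tC U) \<and>
     (\<forall>x y. pM P x y \<in> extensional (hom2 G x y)) \<and> pM P c c id2 = id2 \<and> pM P c' c' id2 = id2 \<and>
     pM P c c' (least2 G c c') = least2 U (Min (tC U)) (Max (tC U)) \<and>
     pM P c c' (greatest2 G c c') = greatest2 U (Min (tC U)) (Max (tC U))"
  (is "_ \<longleftrightarrow> ?rhs")
proof
  assume "is_map2 U G P"
  then show ?rhs
    using lt by (auto simp: is_map2_def dominant_def nondecr_def tC_cell_ball PiE_iff)
next
  assume r: ?rhs
  let ?m = "Min (tC U)" and ?M = "Max (tC U)"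
  have U: "is_ord2 U" and p: "pO P c = ?m" "pO P c' = ?M"
    and ids: "pM P c c id2 = id2" "pM P c' c' id2 = id2"
    and lg: "pM P c c' (least2 G c c') = least2 U ?m ?M"
      "pM P c c' (greatest2 G c c') = greatest2 U ?m ?M"
    using r by auto
  have oU: "ordinal (tC U)"
    using U by (simp add: is_ord2_def)
  note m = ordinal_Min_Max[OF oU]
  note lgU = least2_greatest2_in_hom2[OF U m(1,2,3)]
  have h: "pM P x y \<phi> \<in> hom2 U (pO P x) (pO P y)" if "\<phi> \<in> hom2 G x y" for x y \<phi>
    using that by (cases rule: hom2_cell_ball_cases)
      (use lgU m(1,2) in \<open>auto simp: p ids lg hom2_id2\<close>)
  have dom: "dominant (tC G) (tC U) (pO P)"
    using r m lt by (auto simp: dominant_def nondecr_def tC_cell_ball PiE_iff)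
  have mono: "le2 U (pO P x) (pO P y) (pM P x y \<phi>) (pM P x y \<psi>)"
    if \<phi>: "\<phi> \<in> hom2 G x y" and \<psi>: "\<psi> \<in> hom2 G x y" and le: "le2 G x y \<phi> \<psi>" for x y \<phi> \<psi>
  proof -
    have fin: "finite (tF U a)" "tF U a \<noteq> {}" if "a \<in> arrows (tC U)" for a
      using U that by (auto simp: is_ord2_def ordinal_def)
    have "le2 U ?m ?M (least2 U ?m ?M) (greatest2 U ?m ?M)"
      using fin by (auto simp: le2_def least2_def greatest2_def m(4))
    moreover have "le2 U a b \<chi> \<chi>" for a b \<chi>
      by (simp add: le2_def)
    ultimately have le_U: "le2 U ?m ?M (least2 U ?m ?M) (greatest2 U ?m ?M)" "le2 U a b \<chi> \<chi>" for a b \<chi>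
      by auto
    from \<phi> show ?thesis
      by (cases rule: hom2_cell_ball_cases)
        (use \<psi> le le_U not_greatest2_le2_least2_cell_ball in
          \<open>auto simp: hom2_cell_ball hom2_id2 tC_cell_ball p lg ids\<close>)
  qed
  have cat: "pM P x z (cat2 G x y z \<phi> \<psi>) =
      cat2 U (pO P x) (pO P y) (pO P z) (pM P x y \<phi>) (pM P y z \<psi>)"
    if \<phi>: "\<phi> \<in> hom2 G x y" and \<psi>: "\<psi> \<in> hom2 G y z" for x y z \<phi> \<psi>
  proof -
    have "x = y \<or> y = z"
      using hom2D[OF \<phi>] hom2D[OF \<psi>] lt by (auto simp: tC_cell_ball)
    then show ?thesis
      using h[OF \<phi>] h[OF \<psi>] \<phi> \<psi> by (auto simp: cat2_id2_left cat2_id2_right)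
  qed
  show "is_map2 U G P"
    unfolding is_map2_def
    using U is_ord2_cell_ball dom r h mono cat lt
    by (auto simp: tC_cell_ball)
qed

text \<open>Terminality of the globe. The preceding characterization prescribes every value, and
  extensionality turns agreement of values into equality of records.\<close>

lemma ex1_map2_cell_ball:
  assumes "is_ord2 U"
  shows "\<exists>!P. is_map2 U G P"
proof -
  let ?m = "Min (tC U)" and ?M = "Max (tC U)"
  let ?P = "\<lparr>pO = (\<lambda>x\<in>{c, c'}. if x = c then ?m else ?M),
    pM = (\<lambda>x y. \<lambda>\<phi>\<in>hom2 G x y. if x = y then id2
      else if \<phi> = least2 G c c' then least2 U ?m ?M else greatest2 U ?m ?M)\<rparr>"
  \<comment> \<open>Without this the case distinction in \<open>?P\<close> could send the greatest
    1-arrow to the least one.\<close>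
  have ne: "greatest2 G c c' \<noteq> least2 G c c'"
    using not_greatest2_le2_least2_cell_ball by (auto simp: le2_def)
  show ?thesis
  proof (rule ex1I)
    show "is_map2 U G ?P"
      using assms lt ne by (simp add: is_map2_cell_ball_iff hom2_cell_ball hom2_id2 tC_cell_ball)
  next
    fix P assume P: "is_map2 U G P"
    have "pO P = pO ?P"
      by (rule extensionalityI[of _ "{c, c'}"])
        (use P lt in \<open>auto simp: is_map2_cell_ball_iff\<close>)
    moreover have "pM P x y = pM ?P x y" for x y
    proof (rule extensionalityI[of _ "hom2 G x y"])
      fix \<phi> assume "\<phi> \<in> hom2 G x y"
      then show "pM P x y \<phi> = pM ?P x y \<phi>"
        by (cases rule: hom2_cell_ball_cases)
          (use P lt ne in \<open>auto simp: is_map2_cell_ball_iff hom2_cell_ball hom2_id2 tC_cell_ball\<close>)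
    qed (use P in \<open>auto simp: is_map2_cell_ball_iff\<close>)
    then have "pM P = pM ?P"
      unfolding fun_eq_iff by blast
    ultimately show "P = ?P"
      by (intro map2.equality) simp_all
  qed
qed

end

lemma is_map2_to_globe:
  assumes "is_ord2 U"
  shows "is_map2 U globe2 (to_globe U)"
proof -
  have "globe2 = cell_ball ((0, 1), (0, 1))"
    by (simp add: globe2_def cell_ball_def)
  then show ?thesis
    unfolding to_globe_def using theI'[OF ex1_map2_cell_ball[of 0 1 0 1, OF _ _ assms]] by simp
qed

section \<open>Balls around 2-cells and their preimages\<close>

lemma cellsD:
  assumes "((c, c'), (f, f')) \<in> cells U"
  shows "(c, c') \<in> arrows (tC U)" "(f, f') \<in> arrows (tF U (c, c'))"
    "c \<in> tC U" "c' \<in> tC U" "f \<in> tF U (c, c')" "f' \<in> tF U (c, c')" "c < c'" "f < f'"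
  using assms by (auto simp: cells_def dest: arrowsD)

lemma ball2_cell_ball:
  assumes "g \<in> cells U"
  shows "ball2 (cell_ball g) U"
proof -
  obtain c c' f f' where g: "g = ((c, c'), (f, f'))"
    by (metis prod.exhaust)
  note d = cellsD[OF assms[unfolded g]]
  have "interval {c, c'} (tC U)"
    unfolding interval_def using d arrow_interval[OF d(1)] by (metis less_imp_le)
  moreover have "interval {f, f'} (tF U (c, c'))"
    unfolding interval_def using d arrow_interval[OF d(2)] by (metis less_imp_le)
  ultimately show ?thesis
    using d is_ord2_cell_ball[of c c' f f']
    by (auto simp: ball2_def g tC_cell_ball tF_cell_ball arrows_pair)
qed

text \<open>The preimage of a 2-cell from \<open>f\<close> to \<open>f'\<close> consists of the 1-cells and 2-cells of \<open>U\<close>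
  lying between \<open>[P] f\<close> and \<open>[P] f'\<close>.\<close>

lemma ball2_cpre:
  assumes P: "is_map2 U V P" and g: "g \<in> cells V"
  shows "ball2 (cpre U P g) U"
proof -
  obtain c c' f f' where g_eq: "g = ((c, c'), (f, f'))"
    by (metis prod.exhaust)
  note d = cellsD[OF g[unfolded g_eq]]
  define G where "G = cell_ball g"
  \<comment> \<open>The images under [P] of the two boundary 1-arrows of the cell;
    \<open>lo a\<close> and \<open>hi a\<close> will bound the part of the preimage over the arrow
    \<open>a\<close>.\<close>
  define lo hi where "lo = pM P c c' (least2 G c c')" and "hi = pM P c c' (greatest2 G c c')"
  define x y where "x = pO P c" and "y = pO P c'"
  define W where "W = \<lparr>tC = tC U \<inter> {x..y},
    tF = (\<lambda>a. if a \<in> arrows (tC U \<inter> {x..y}) then tF U a \<inter> {lo a..hi a} else {})\<rparr>"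
  have G: "G = cell_ball ((c, c'), f, f')"
    by (simp add: G_def g_eq)
  have U: "is_ord2 U" and V: "is_ord2 V"
    using P by (auto simp: is_map2_def)
  have fin: "finite (tC U)" "\<And>a. a \<in> arrows (tC U) \<Longrightarrow> finite (tF U a)"
    using U by (auto simp: is_ord2_def ordinal_def)
  have xy: "x \<in> tC U" "y \<in> tC U" "x \<le> y"
    using P d by (auto simp: is_map2_def dominant_def nondecr_def x_def y_def)
  have G_V: "hom2 G c c' \<subseteq> hom2 V c c'"
    unfolding G_def by (rule ball2_hom2_subset[OF ball2_cell_ball[OF g]])
  have lohi_V: "least2 G c c' \<in> hom2 V c c'" "greatest2 G c c' \<in> hom2 V c c'"
    using G_V hom2_cell_ball[of c c' f f'] d by (auto simp: G)
  have lohi: "lo \<in> hom2 U x y" "hi \<in> hom2 U x y"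
    using P lohi_V d by (auto simp: is_map2_def lo_def hi_def x_def y_def Pi_iff)
  \<comment> \<open>The 2-cell is itself a 2-arrow of [V]. Monotonicity of [P] turns it into
    \<open>lo\<close> below \<open>hi\<close>, and so the intervals used in \<open>W\<close> are
    non-empty.\<close>
  have "le2 V c c' (least2 G c c') (greatest2 G c c')"
    using d arrow_interval[OF d(1)] by (simp add: le2_def G least2_cell_ball greatest2_cell_ball
        arrows_pair)
  then have "le2 U x y lo hi"
    using P lohi_V d by (auto simp: is_map2_def lo_def hi_def x_def y_def)
  then have mem: "lo a \<in> tF U a" "hi a \<in> tF U a" "lo a \<le> hi a"
    if "a \<in> arrows (tC U \<inter> {x..y})" for a
    using lohi that xy by (auto simp: hom2_def le2_def)
  have finF: "finite (tF U a)" if "a \<in> arrows (tC U \<inter> {x..y})" for a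
    using that fin arrows_interval_subset by blast
  have ordW: "is_ord2 W"
  proof -
    have "ordinal (tC W)"
      using xy fin by (auto simp: W_def ordinal_def)
    moreover have "ordinal (tF W a)" if "a \<in> arrows (tC W)" for a
    proof -
      have a: "a \<in> arrows (tC U \<inter> {x..y})"
        using that by (simp add: W_def)
      then have "lo a \<in> tF W a"
        using mem[OF a] by (simp add: W_def)
      then show ?thesis
        using finF[OF a] a by (auto simp: W_def ordinal_def)
    qed
    moreover have "tF W a = {}" if "a \<notin> arrows (tC W)" for a
      using that by (simp add: W_def)
    ultimately show ?thesis
      by (simp add: is_ord2_def)
  qed
  have ballW: "ball2 W U"
  proof -
    have "interval (tC W) (tC U)"
      using xy by (auto simp: W_def interval_def)
    moreover have "interval (tF W a) (tF U a)" if "a \<in> arrows (tC W)" for a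
    proof -
      have a: "a \<in> arrows (tC U \<inter> {x..y})"
        using that by (simp add: W_def)
      show ?thesis
        unfolding interval_def using mem[OF a] a by (auto simp: W_def)
    qed
    ultimately show ?thesis
      using ordW by (simp add: ball2_def)
  qed
  have mm: "Min (tC U \<inter> {x..y}) = x" "Max (tC U \<inter> {x..y}) = y"
    using xy fin by (auto simp: Min_interval Max_interval)
  \<comment> \<open>These are the conditions on 1-arrows in \<open>is_map2_cell_ball_iff\<close>.
    They hold because \<open>lo a\<close> and \<open>hi a\<close> belong to \<open>tF U a\<close>,
    so that the bounds are attained.\<close>
  have lo_W: "lo = least2 W x y" and hi_W: "hi = greatest2 W x y"
  proof -
    have eq: "tC W \<inter> {x..y} = tC U \<inter> {x..y}"
      by (auto simp: W_def)
    show "lo = least2 W x y"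
      unfolding least2_def eq using lohi mem finF xy
      by (intro extensionalityI[of _ "arrows (tC U \<inter> {x..y})"])
        (auto simp: W_def hom2_def Min_interval PiE_iff)
    show "hi = greatest2 W x y"
      unfolding greatest2_def eq using lohi mem finF xy
      by (intro extensionalityI[of _ "arrows (tC U \<inter> {x..y})"])
        (auto simp: W_def hom2_def Max_interval PiE_iff)
  qed
  have res: "pM (restrict2 G P) c c' (least2 G c c') = lo"
    "pM (restrict2 G P) c c' (greatest2 G c c') = hi"
    "pO (restrict2 G P) c = x" "pO (restrict2 G P) c' = y"
    using d by (auto simp: restrict2_def G hom2_cell_ball tC_cell_ball lo_def hi_def x_def y_def)
  have "is_map2 W G (restrict2 G P)"
    unfolding G is_map2_cell_ball_iff[OF d(7,8)]
    unfolding G[symmetric] res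
    using ordW mm lo_W hi_W P d
    by (auto simp: W_def restrict2_def G hom2_id2 tC_cell_ball is_map2_def)
  \<comment> \<open>Uniqueness: the map to the globe fixes the minimum and maximum of
    \<open>tC W'\<close> and of each \<open>tF W' a\<close>, and in a ball these sets are intervals.
    Off the arrows \<open>is_ord2\<close> makes both sides empty.\<close>
  moreover have "W' = W" if W': "ball2 W' U" "is_map2 W' G (restrict2 G P)" for W'
  proof -
    have o: "is_ord2 W'"
      using W' by (simp add: is_map2_def)
    have 1: "x = Min (tC W')" "y = Max (tC W')" "lo = least2 W' x y" "hi = greatest2 W' x y"
      using W'(2) unfolding G is_map2_cell_ball_iff[OF d(7,8)]
      unfolding G[symmetric] res by auto
    have C: "tC W' = tC U \<inter> {x..y}"
      using interval_Min_Max[of "tC W'" "tC U"] W'(1) fin by (simp add: ball2_def flip: 1)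
    have "tF W' a = tF W a" for a
    proof (cases "a \<in> arrows (tC U \<inter> {x..y})")
      case True
      have eq: "tC W' \<inter> {x..y} = tC U \<inter> {x..y}"
        by (auto simp: C)
      have "lo a = Min (tF W' a)" "hi a = Max (tF W' a)"
        by (use True in \<open>simp_all add: 1(3,4) least2_def greatest2_def eq\<close>)
      then show ?thesis
        using interval_Min_Max[of "tF W' a" "tF U a"] W'(1) finF True
        by (simp add: ball2_def C W_def)
    next
      case False
      then show ?thesis
        using o by (cases a) (simp add: is_ord2_def C W_def)
    qed
    then show ?thesis
      using C by (cases W') (auto simp: W_def fun_eq_iff)
  qed
  ultimately have "preim U P G = W"
    unfolding preim_def using ballW by (intro the_equality conjI) (blast, blast, blast)
  then show ?thesis
    using ballW by (simp add: G_def)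
qed


section \<open>Inverse maps\<close>

lemma is_map2_pO: "is_map2 U V P \<Longrightarrow> c \<in> tC V \<Longrightarrow> pO P c \<in> tC U"
  by (auto simp: is_map2_def dominant_def nondecr_def)

lemma is_map2_pM:
  assumes "is_map2 U V P" "\<phi> \<in> hom2 V c c'"
  shows "pM P c c' \<phi> \<in> hom2 U (pO P c) (pO P c')"
proof (rule funcset_mem[OF _ assms(2)])
  show "pM P c c' \<in> hom2 V c c' \<rightarrow> hom2 U (pO P c) (pO P c')"
    using assms(1) hom2D[OF assms(2)] unfolding is_map2_def by simp
qed

lemma map2_eqI:
  assumes "is_map2 U V P" "is_map2 U V Q"
    and "\<And>c. c \<in> tC V \<Longrightarrow> pO P c = pO Q c"
    and "\<And>c c' \<phi>. \<phi> \<in> hom2 V c c' \<Longrightarrow> pM P c c' \<phi> = pM Q c c' \<phi>"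
  shows "P = Q"
proof -
  have "pO P = pO Q"
    using assms by (intro extensionalityI[of _ "tC V"])
      (auto simp: is_map2_def dominant_def nondecr_def PiE_iff)
  moreover have "pM P c c' = pM Q c c'" for c c'
    using assms by (intro extensionalityI[of _ "hom2 V c c'"]) (auto simp: is_map2_def)
  then have "pM P = pM Q"
    unfolding fun_eq_iff by blast
  ultimately show ?thesis
    by (intro map2.equality) simp_all
qed

lemma comp_map2_apply:
  "c \<in> tC W \<Longrightarrow> pO (comp_map2 W Q P) c = pO P (pO Q c)"
  "\<phi> \<in> hom2 W c c' \<Longrightarrow> pM (comp_map2 W Q P) c c' \<phi> = pM P (pO Q c) (pO Q c') (pM Q c c' \<phi>)"
  by (auto simp: comp_map2_def compose_def)

lemma id_map2_apply:
  "c \<in> tC U \<Longrightarrow> pO (id_map2 U) c = c" "\<phi> \<in> hom2 U c c' \<Longrightarrow> pM (id_map2 U) c c' \<phi> = \<phi>"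
  by (auto simp: id_map2_def)

text \<open>As [P][Q] and [Q'][P] are identities, [Q] = [Q'][P][Q] = [Q']. Objects come first, since
  the maps on 1-arrows are indexed by end points. This makes \<open>inv2\<close> well
  defined.\<close>

lemma inverse_maps2_unique:
  assumes "inverse_maps2 U V P Q" "inverse_maps2 U V P Q'"
  shows "Q = Q'"
proof (rule map2_eqI)
  show Q: "is_map2 V U Q" and Q': "is_map2 V U Q'"
    using assms by (auto simp: inverse_maps2_def)
  have l: "comp_map2 U Q P = id_map2 U" and r: "comp_map2 V P Q' = id_map2 V"
    using assms by (auto simp: inverse_maps2_def)
  have O: "pO Q c = pO Q' c" if c: "c \<in> tC U" for c
  proof -
    have "pO P (pO Q c) = c"
      using comp_map2_apply(1)[OF c, of Q P] id_map2_apply(1)[OF c] by (simp add: l)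
    moreover have "pO Q' (pO P (pO Q c)) = pO Q c"
      using comp_map2_apply(1)[OF is_map2_pO[OF Q c], of P Q'] is_map2_pO[OF Q c]
      by (simp add: r id_map2_apply)
    ultimately show ?thesis
      by simp
  qed
  then show "pO Q c = pO Q' c" if "c \<in> tC U" for c
    using that .
  fix c c' \<phi> assume \<phi>: "\<phi> \<in> hom2 U c c'"
  note c = hom2D[OF \<phi>] and Q\<phi> = is_map2_pM[OF Q \<phi>]
  have PO: "pO P (pO Q a) = a" if "a \<in> tC U" for a
    using comp_map2_apply(1)[OF that, of Q P] id_map2_apply(1)[OF that] by (simp add: l)
  have "pM P (pO Q c) (pO Q c') (pM Q c c' \<phi>) = \<phi>"
    using comp_map2_apply(2)[OF \<phi>, of Q P] id_map2_apply(2)[OF \<phi>] by (simp add: l)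
  moreover have "pM Q' c c' (pM P (pO Q c) (pO Q c') (pM Q c c' \<phi>)) = pM Q c c' \<phi>"
    using comp_map2_apply(2)[OF Q\<phi>, of P Q'] id_map2_apply(2)[OF Q\<phi>] c by (simp add: r PO)
  ultimately show "pM Q c c' \<phi> = pM Q' c c' \<phi>"
    by simp
qed

lemma is_map2_inv2:
  assumes "iso2 U V \<phi>"
  shows "is_map2 V U (inv2 U V \<phi>)"
proof -
  have "\<exists>!Q. inverse_maps2 U V \<phi> Q"
    using assms inverse_maps2_unique by (auto simp: iso2_def)
  then have "inverse_maps2 U V \<phi> (inv2 U V \<phi>)"
    unfolding inv2_def by (rule theI')
  then show ?thesis
    by (simp add: inverse_maps2_def)
qed


section \<open>Constant diagrams\<close>

text \<open>This is the compatibility of a constant diagram with concatenation. It is an equality of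
  records, both sides being \<open>undefined\<close> off the same domains.\<close>

lemma comp_fun_id_fun: "comp_fun A (id_fun A) (id_fun A) = id_fun A"
  by (auto simp: comp_fun_def id_fun_def compose_def restrict_def fun_eq_iff morset_def)

lemma const_diag_in_diagrams:
  assumes "dg_subcategory R C" "A \<in> cOb C"
  shows "const_diag A U \<in> diagrams C U"
  using assms
  by (auto simp: diagrams_def const_diag_def dg_subcategory_def hom2_id2 cat2_in_hom2
      comp_fun_id_fun dest: hom2D)

text \<open>The values of [P] lie where the diagram over \<open>U\<close> is defined, so the
  composite takes the constant value there and not \<open>undefined\<close>.\<close>

lemma push_diag_const_diag:
  assumes "is_map2 U V P"
  shows "push_diag V P (const_diag A U) = const_diag A V"
  using is_map2_pO[OF assms] is_map2_pM[OF assms]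
  by (auto simp: push_diag_def const_diag_def compose_def restrict_def fun_eq_iff)

lemma restrict_diag_const_diag:
  assumes "ball2 U' U"
  shows "restrict_diag U' (const_diag A U) = const_diag A U'"
proof -
  have "tC U' \<subseteq> tC U"
    using assms by (auto simp: ball2_def interval_def)
  then show ?thesis
    using ball2_hom2_subset[OF assms]
    by (auto simp: restrict_diag_def const_diag_def restrict_def fun_eq_iff)
qed

lemma globe_of_const_diag:
  assumes "is_ord2 G"
  shows "globe_of G (const_diag A G) = (A, A, id_fun A, id_fun A)"
proof -
  have "ordinal (tC G)"
    using assms by (simp add: is_ord2_def)
  note m = ordinal_Min_Max[OF this]
  show ?thesis
    using least2_greatest2_in_hom2[OF assms m(1,2,3)] m
    by (simp add: globe_of_def Let_def const_diag_def)
qed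

text \<open>Together with \<open>out_globe_const_diag\<close> this places all inputs and the output
  of an operation at a constant diagram in one and the same complex.\<close>

lemma in_globe_const_diag:
  assumes "f \<in> cells U"
  shows "in_globe (const_diag A U) f = (A, A, id_fun A, id_fun A)"
  using ball2_cell_ball[OF assms]
  by (simp add: in_globe_def restrict_diag_const_diag globe_of_const_diag ball2_def)

lemma out_globe_const_diag:
  assumes "is_ord2 U"
  shows "out_globe U (const_diag A U) = (A, A, id_fun A, id_fun A)"
proof -
  note t = is_map2_to_globe[OF assms]
  then have "is_ord2 globe2"
    by (simp add: is_map2_def)
  then show ?thesis
    by (simp add: out_globe_def push_diag_const_diag[OF t] globe_of_const_diag)
qed


section \<open>Specialization of operations to constant diagrams\<close>

lemma pure_cong: "(\<And>i. i \<in> set L \<Longrightarrow> M i = M' i) \<Longrightarrow> pure M L = pure M' L"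
  by (simp add: pure_def cong: PiE_cong)

text \<open>\<open>finsum\<close> is defined by a description over \<open>foldSetD\<close>;
  congruence is proved for this inductive relation, where no algebraic laws enter.\<close>

lemma foldSetD_cong:
  assumes "(A, y) \<in> foldSetD D f e" "\<And>x. x \<in> A \<Longrightarrow> f x = g x"
  shows "(A, y) \<in> foldSetD D g e"
  using assms
proof (induction rule: foldSetD.induct)
  case (insertI x A y)
  then show ?case
    using foldSetD.insertI[of x A g y] by simp
qed (rule foldSetD.emptyI)

text \<open>Unlike the congruence rules of the library, this one does not presuppose that \<open>G\<close> is an
  abelian monoid or that the summands lie in its carrier.\<close>

lemma finsum_cong_on:
  assumes "A = B" "\<And>x. x \<in> B =simp=> f x = g x"
  shows "finsum G f A = finsum G g B"
proof -
  let ?M = "add_monoid G"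
  have eq: "(monoid.mult ?M \<circ> f) x = (monoid.mult ?M \<circ> g) x" if "x \<in> B" for x
    using assms(2) that by (simp add: simp_implies_def)
  have "(B, y) \<in> foldSetD (carrier ?M) (monoid.mult ?M \<circ> f) \<one>\<^bsub>?M\<^esub> \<longleftrightarrow>
      (B, y) \<in> foldSetD (carrier ?M) (monoid.mult ?M \<circ> g) \<one>\<^bsub>?M\<^esub>" for y
    by (rule iffI; erule foldSetD_cong) (simp_all only: eq)
  then show ?thesis
    unfolding finsum_def finprod_def foldD_def assms(1) by simp
qed

text \<open>The family of complexes of a constant diagram agrees with a constant family at 2-cells
  only, so equality is asked on \<open>L\<close> alone. The sum in the differential is handled by
  \<open>finsum_cong_on\<close>.\<close>

lemma hom_cx_cong:
  assumes "\<And>i. i \<in> set L \<Longrightarrow> M i = M' i"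
  shows "hom_cx R M L N = hom_cx R M' L N"
proof -
  have p: "pure M L = pure M' L"
    by (rule pure_cong) (rule assms)
  have n: "M (L ! j) = M' (L ! j)" if "j < length L" for j
    using assms that by simp
  show ?thesis
    unfolding hom_cx_def p Let_def
    by (simp add: assms n cong: finsum_cong_on restrict_cong)
qed

lemma chain_map_prod_cx_component:
  assumes "chain_map R K (prod_cx J L) \<phi>" "j \<in> J"
  shows "chain_map R K (L j) (\<lambda>n x. \<phi> n x j)"
  using assms
  by (auto simp: chain_map_def lin_def prod_cx_def mk_mod_def Pi_iff PiE_iff)

lemma tdeg_cong: "(\<And>i. i \<in> set L \<Longrightarrow> fst (h i) = fst (h' i)) \<Longrightarrow> tdeg L h = tdeg L h'"
  by (simp add: tdeg_def)

lemma kosz_cong: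
  assumes "\<And>i. i \<in> set L \<Longrightarrow> d i = d' i"
  shows "kosz d L L' = kosz d' L L'"
proof -
  have "before L a b \<Longrightarrow> a \<in> set L \<and> b \<in> set L" for a b
    by (auto simp: before_def)
  then show ?thesis
    unfolding kosz_def using assms by (intro sum.cong) auto
qed

text \<open>\<open>insert_op\<close> reads \<open>a\<close> only at the indices in
  \<open>op_list V\<close>. The argument families formed in \<open>full\<close> and
  \<open>full1\<close> may differ off this list and still give the same composite.\<close>

lemma insert_op_cong:
  assumes V: "is_ord2 V" and a: "\<And>i. i \<in> set (op_list V) \<Longrightarrow> a i = a' i"
  shows "insert_op N U V P a h = insert_op N U V P a' h"
proof -
  have s: "\<And>f. f \<in> cells V \<Longrightarrow> a (Some f) = a' (Some f)" "a None = a' None"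
    using a V by (auto simp: set_op_list)
  have t: "tdeg (op_list V) a = tdeg (op_list V) a'"
    using a by (intro tdeg_cong) auto
  have k: "kosz (case_sum (fst \<circ> a) (fst \<circ> h)) (map Inl (op_list V) @ map Inr (cell_list U)) L' =
      kosz (case_sum (fst \<circ> a') (fst \<circ> h)) (map Inl (op_list V) @ map Inr (cell_list U)) L'" for L'
    by (rule kosz_cong) (auto simp: a)
  show ?thesis
    unfolding insert_op_def Let_def t k by (simp add: s cong: restrict_cong)
qed

text \<open>Each condition in \<open>operad_map\<close> for \<open>full1\<close> is the one for
  \<open>full\<close> evaluated at a constant diagram. This works for any C-complex; the Hochschild
  complex is the case of \<open>Rhom\<close>.\<close>

lemma single_algebra2_const_diag:
  assumes C: "dg_subcategory R C" "A \<in> cOb C" and alg: "algebra2 R C Op K \<nu>"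
  shows "single_algebra2 R Op (K (A, A, id_fun A, id_fun A)) (\<lambda>U n x. \<nu> U n x (const_diag A U))"
proof -
  let ?g = "(A, A, id_fun A, id_fun A)"
  let ?D = "const_diag A"
  have D: "?D U \<in> diagrams C U" for U
    by (rule const_diag_in_diagrams[OF C])
  have alg': "operad_map R Op (full R C K) \<nu>"
    using alg by (simp add: algebra2_def)
  have fam: "diag_fam K (?D U) f = K ?g" if "is_ord2 U" "f \<in> set (cell_list U)" for U f
    using that by (simp add: set_cell_list in_globe_const_diag)
  have pureD: "pure (diag_fam K (?D U)) (cell_list U) = pure (\<lambda>_. K ?g) (cell_list U)"
    if "is_ord2 U" for U
    by (rule pure_cong) (rule fam[OF that])
  \<comment> \<open>An equality of complexes, so that no comparison isomorphism intervenes
    below.\<close>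
  have homD: "hom_cx R (diag_fam K (?D U)) (cell_list U) (K (out_globe U (?D U))) =
      opOb (full1 R (K ?g)) U" if "is_ord2 U" for U
    using hom_cx_cong[OF fam[OF that]] by (simp add: full1_def out_globe_const_diag[OF that])
  have "chain_map R (opOb Op U) (opOb (full1 R (K ?g)) U) (\<lambda>n x. \<nu> U n x (?D U))"
    if U: "is_ord2 U" for U
  proof -
    have "chain_map R (opOb Op U) (opOb (full R C K) U) (\<nu> U)"
      using alg' U by (simp add: operad_map_def)
    from chain_map_prod_cx_component[OF this[unfolded full_def operad2.simps] D] show ?thesis
      by (simp add: homD[OF U])
  qed
  moreover have "\<nu> V n (opIso Op U V \<phi> n x) (?D V) =
      opIso (full1 R (K ?g)) U V \<phi> n (\<nu> U n x (?D U))"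
    if \<phi>: "iso2 U V \<phi>" and x: "(n, x) \<in> hel (opOb Op U)" for U V \<phi> n x
  proof -
    \<comment> \<open>\<open>full\<close> transports diagrams along \<open>inv2\<close>, which must
      be a genuine map for the result to be constant.\<close>
    have m: "is_map2 V U (inv2 U V \<phi>)"
      by (rule is_map2_inv2[OF \<phi>])
    then have V: "is_ord2 V"
      by (simp add: is_map2_def)
    have "\<nu> V n (opIso Op U V \<phi> n x) = opIso (full R C K) U V \<phi> n (\<nu> U n x)"
    proof -
      have "\<forall>(n, x)\<in>hel (opOb Op U).
          \<nu> V n (opIso Op U V \<phi> n x) = opIso (full R C K) U V \<phi> n (\<nu> U n x)"
        using alg' \<phi> unfolding operad_map_def by blast
      from bspec[OF this x] show ?thesis
        by simp
    qed
    then show ?thesis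
      by (simp add: full_def full1_def D pureD[OF V] push_diag_const_diag[OF m])
  qed
  moreover have "\<nu> U (tdeg (op_list V) a) (opComp Op U V P a) (?D U) =
      opComp (full1 R (K ?g)) U V P (op_args V
        (\<lambda>f. (fst (a (Some f)),
          \<nu> (cpre U P f) (fst (a (Some f))) (snd (a (Some f))) (?D (cpre U P f))))
        (fst (a None), \<nu> V (fst (a None)) (snd (a None)) (?D V)))"
    if P: "is_map2 U V P" and a: "a \<in> pure (op_fam Op U V P) (op_list V)" for U V P a
  proof -
    let ?b = "op_args V
      (\<lambda>f. (fst (a (Some f)), \<nu> (cpre U P f) (fst (a (Some f))) (snd (a (Some f)))))
      (fst (a None), \<nu> V (fst (a None)) (snd (a None)))"
    have U: "is_ord2 U" and V: "is_ord2 V"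
      using P by (auto simp: is_map2_def)
    have eq: "\<nu> U (tdeg (op_list V) a) (opComp Op U V P a) = opComp (full R C K) U V P ?b"
      using alg' P a unfolding operad_map_def by blast
    \<comment> \<open>Preimages of 2-cells are balls by \<open>ball2_cpre\<close>, so the restricted
      diagrams met in the composition of \<open>full\<close> are again constant.\<close>
    show ?thesis
      unfolding eq
      by (simp add: full_def full1_def D pureD[OF U] out_globe_const_diag[OF U],
          intro restrict_ext insert_op_cong[OF V])
        (auto simp: set_op_list[OF V] op_args_def push_diag_const_diag[OF P]
          restrict_diag_const_diag[OF ball2_cpre[OF P]])
  qed
  ultimately show ?thesis
    unfolding single_algebra2_def operad_map_def by blast
qed

theorem proposition7p1:
  fixes R :: "('k, 'r) ring_scheme"
    and C :: "('k, 'o, 'm) subcat"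
    and Op :: "('k, 'p) operad2"
  assumes "cring R"
    and "dg_subcategory R C"
    and "contractible R Op \<epsilon>"
    and "algebra2 R C Op (naive_hom R) \<mu>"
    and "algebra2 R C Op (Rhom R) \<nu>"
    and "algebra2_map R C Op (naive_hom R) \<mu> (Rhom R) \<nu> (natural_map R)"
    and "\<forall>U. is_ord2 U \<longrightarrow> (\<forall>(n, x)\<in>hel (opOb Op U). \<mu> U n x = std_alg R C U n (\<epsilon> U n x))"
    and "A \<in> cOb C"
  shows "single_algebra2 R Op (Hoch R A) (\<lambda>U n x. \<nu> U n x (const_diag A U))"
  unfolding Hoch_def using assms by (intro single_algebra2_const_diag)

end
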